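(* Let $k$ be an algebraically closed field of characteristic $p>0$, let $n,a$ be integers with $1\le a\le n-1$, $\gcd(a,n)=1$ and $p\nmid n$, and let $R=k[[x,y]]^G$ be the invariant ring of the cyclic group $G=\frac1n(1,a)$. Write $n/a=[\alpha_1,\dots,\alpha_r]$ for the Hirzebruch–Jung continued fraction expansion, and let $(i_t)$ and $(j_t)$ be the associated $i$-series and $j$-series. For every non-free indecomposable special Cohen–Macaulay $R$-module $M_{i_t}$ ($t=1,\dots,r$), the dual $F$-signature of $M_{i_t}$ is $$s(M_{i_t})=\begin{cases}\dfrac{\min(i_t,j_t)+1}{n} & \text{if } i_t\neq j_t,\\[2mm] \dfrac{2i_t+1}{2n} & \text{if } i_t=j_t.\end{cases}$$
   Context: **Group and ring.** $\frac1n(1,a)$ denotes the cyclic subgroup of $\mathrm{GL}(2,k)$ generated by $\sigma=\mathrm{diag}(\zeta_n,\zeta_n^a)$, where $\zeta_n\in k$ is a primitive $n$-th root of unity. It acts on $S=k[[x,y]]$ by $\sigma x=\zeta_n x$, $\sigma y=\zeta_n^a y$, and $R=S^G$ is the invariant ring, a local ring of dimension $2$. **The modules $M_t$.** For an integer $t$ (taken modulo $n$), $$M_t=\Bigl\{\sum_{i,j} a_{ij}x^iy^j\in S \;\Big|\; a_{ij}\in k,\ a_{ij}=0 \text{ unless } i+ja\equiv t \pmod n\Bigr\},$$ an $R$-submodule of $S$. The modules $M_0=R,M_1,\dots,M_{n-1}$ are all the indecomposable maximal Cohen–Macaulay (MCM) $R$-modules up to isomorphism; each has rank one. **Special CM modules.**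 An MCM $R$-module $M$ is called special if $(M\otimes_R\omega_R)/\mathrm{torsion}$ is also an MCM $R$-module, where $\omega_R$ is the canonical module of $R$. **Continued fraction and series.** $[\alpha_1,\dots,\alpha_r]=\alpha_1-\cfrac{1}{\alpha_2-\cfrac{1}{\cdots-\frac{1}{\alpha_r}}}$ with integers $\alpha_l\ge 2$. The $i$-series and $j$-series are defined by $i_0=n$, $i_1=a$, $i_t=\alpha_{t-1}i_{t-1}-i_{t-2}$ and $j_0=0$, $j_1=1$, $j_t=\alpha_{t-1}j_{t-1}-j_{t-2}$ for $t=2,\dots,r+1$. By a known theorem of Wunram, the indecomposable special CM $R$-modules are exactly $M_{i_0}=R$ and $M_{i_1},\dots,M_{i_r}$, and for $1\le t\le r$ the module $M_{i_t}=Rx^{i_t}+Ry^{j_t}$ is minimally generated by $x^{i_t},y^{j_t}$. **Dual $F$-signature.** For an $R$-module $M$ and $e\in\mathbb N$, ${}^eM$ is the abelian group $M$ with $R$-module structure $r\cdot m=r^{p^e}m$. For a finitely generated $R$-module $M$, put $b_e(M)=\max\{m \mid \text{there is a surjective } R\text{-linear map } {}^eM\to M^{\oplus m}\}$. The dual $F$-signature of $M$ is $s(M)=\lim_{e\to\infty} b_e(M)/p^{ed}$ (if the limit exists), where $d=\dim R=2$ here. *)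

theory Defs
  imports
    Complex_Main
    "HOL-Library.FuncSet"
    "HOL-Number_Theory.Cong"
    "HOL-Computational_Algebra.Computational_Algebra"
    "HOL-Algebra.Module"
begin

section \<open>Dual F-signature of a module\<close>

definition module_hom ::
    "('r, 'x) ring_scheme \<Rightarrow> ('r, 'm, 'y) module_scheme \<Rightarrow> ('r, 'n, 'z) module_scheme \<Rightarrow> ('m \<Rightarrow> 'n) set"
  where
    "module_hom R M N = {f. f \<in> carrier M \<rightarrow> carrier N
       \<and> (\<forall>x\<in>carrier M. \<forall>y\<in>carrier M. f (x \<oplus>\<^bsub>M\<^esub> y) = f x \<oplus>\<^bsub>N\<^esub> f y)
       \<and> (\<forall>r\<in>carrier R. \<forall>x\<in>carrier M. f (r \<odot>\<^bsub>M\<^esub> x) = r \<odot>\<^bsub>N\<^esub> f x)}"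

text \<open>The module with the same abelian group as \<open>M\<close> and scalar action
  \<open>r \<cdot> x = r\<^sup>q x\<close> where \<open>q = p ^ e\<close>.\<close>

definition frobenius_twist ::
    "('r, 'x) ring_scheme \<Rightarrow> nat \<Rightarrow> nat \<Rightarrow> ('r, 'm) module \<Rightarrow> ('r, 'm) module"
  where
    "frobenius_twist R p e M = M\<lparr>smult := \<lambda>r x. (r [^]\<^bsub>R\<^esub> (p ^ e)) \<odot>\<^bsub>M\<^esub> x\<rparr>"

text \<open>The direct sum of \<open>m\<close> copies of \<open>M\<close>. Module records extend ring records, so the
  fields \<open>mult\<close> and \<open>one\<close> have to be filled in, but they play no role for modules.\<close>

definition direct_power :: "('r, 'm) module \<Rightarrow> nat \<Rightarrow> ('r, nat \<Rightarrow> 'm) module"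
  where
    "direct_power M m =
       \<lparr>carrier = {..<m} \<rightarrow>\<^sub>E carrier M,
        mult = (\<lambda>f g. \<lambda>i\<in>{..<m}. f i \<otimes>\<^bsub>M\<^esub> g i),
        one = (\<lambda>i\<in>{..<m}. \<one>\<^bsub>M\<^esub>),
        zero = (\<lambda>i\<in>{..<m}. \<zero>\<^bsub>M\<^esub>),
        add = (\<lambda>f g. \<lambda>i\<in>{..<m}. f i \<oplus>\<^bsub>M\<^esub> g i),
        smult = (\<lambda>r f. \<lambda>i\<in>{..<m}. r \<odot>\<^bsub>M\<^esub> f i)\<rparr>"

definition dual_F_number :: "('r, 'x) ring_scheme \<Rightarrow> nat \<Rightarrow> ('r, 'm) module \<Rightarrow> nat \<Rightarrow> nat"
  where
    "dual_F_number R p M e =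
       Max {m. \<exists>f \<in> module_hom R (frobenius_twist R p e M) (direct_power M m).
                 f ` carrier (frobenius_twist R p e M) = carrier (direct_power M m)}"

text \<open>\<open>has_dual_F_signature R p d M s\<close> says that the limit defining the dual F-signature of
  \<open>M\<close> exists and equals \<open>s\<close>; here \<open>p\<close> is the characteristic and \<open>d\<close> the dimension of \<open>R\<close>.\<close>

definition has_dual_F_signature ::
    "('r, 'x) ring_scheme \<Rightarrow> nat \<Rightarrow> nat \<Rightarrow> ('r, 'm) module \<Rightarrow> real \<Rightarrow> bool"
  where
    "has_dual_F_signature R p d M s \<longleftrightarrow>
       (\<lambda>e. real (dual_F_number R p M e) / real p ^ (e * d)) \<longlonglongrightarrow> s"


section \<open>Invariants of a cyclic group acting on \<open>k[[x,y]]\<close>\<close>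

text \<open>\<open>k[[x,y]]\<close> is the type \<open>'k fps fps\<close>; the coefficient of \<open>x\<^sup>i y\<^sup>j\<close> in \<open>f\<close> is
  \<open>f $ i $ j\<close>.\<close>

definition primitive_root_of_unity :: "nat \<Rightarrow> 'k::field \<Rightarrow> bool"
  where
    "primitive_root_of_unity n z \<longleftrightarrow> 0 < n \<and> z ^ n = 1 \<and> (\<forall>m. 0 < m \<and> m < n \<longrightarrow> z ^ m \<noteq> 1)"

text \<open>The group generated by \<open>diag(z, z\<^sup>a)\<close>, with \<open>diag(u, v)\<close> encoded as \<open>(u, v)\<close>. As \<open>z\<close>
  will be a root of unity, the nonnegative powers of the generator form a group.\<close>

definition cyclic_diag_group :: "'k::field \<Rightarrow> nat \<Rightarrow> ('k \<times> 'k) set"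
  where
    "cyclic_diag_group z a = {(z ^ m, (z ^ a) ^ m) | m. True}"

text \<open>\<open>diag(u, v)\<close> acts by \<open>x \<mapsto> u x\<close>, \<open>y \<mapsto> v y\<close>.\<close>

definition diag_act :: "'k::field \<times> 'k \<Rightarrow> 'k fps fps \<Rightarrow> 'k fps fps"
  where
    "diag_act g f = Abs_fps (\<lambda>i. Abs_fps (\<lambda>j. fst g ^ i * snd g ^ j * f $ i $ j))"

definition invariant_ring :: "('k::field \<times> 'k) set \<Rightarrow> 'k fps fps ring"
  where
    "invariant_ring G =
       \<lparr>carrier = {f. \<forall>g\<in>G. diag_act g f = f}, mult = (*), one = 1, zero = 0, add = (+)\<rparr>"

definition M_module :: "nat \<Rightarrow> nat \<Rightarrow> int \<Rightarrow> ('k::field fps fps, 'k fps fps) module"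
  where
    "M_module n a t =
       \<lparr>carrier = {f. \<forall>i j. \<not> [int i + int j * int a = t] (mod int n) \<longrightarrow> f $ i $ j = 0},
        mult = (*), one = 1, zero = 0, add = (+), smult = (*)\<rparr>"


section \<open>Hirzebruch-Jung continued fractions\<close>

fun hj_fraction :: "int list \<Rightarrow> rat"
  where
    "hj_fraction [c] = of_int c"
  | "hj_fraction (c # d # cs) = of_int c - 1 / hj_fraction (d # cs)"

text \<open>The indexing \<open>\<alpha>\<^sub>1, \<dots>, \<alpha>\<^sub>r\<close> starts at 1, list indexing at 0; thus
  \<open>\<alpha>\<^sub>t\<^sub>+\<^sub>1\<close> is \<open>cs ! t\<close>. Only the values at \<open>0, \<dots>, r + 1\<close> are meaningful.\<close>

fun i_series :: "nat \<Rightarrow> nat \<Rightarrow> int list \<Rightarrow> nat \<Rightarrow> int"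
  where
    "i_series n a cs 0 = int n"
  | "i_series n a cs (Suc 0) = int a"
  | "i_series n a cs (Suc (Suc t)) = cs ! t * i_series n a cs (Suc t) - i_series n a cs t"

fun j_series :: "int list \<Rightarrow> nat \<Rightarrow> int"
  where
    "j_series cs 0 = 0"
  | "j_series cs (Suc 0) = 1"
  | "j_series cs (Suc (Suc t)) = cs ! t * j_series cs (Suc t) - j_series cs t"

end

theory Submission
  imports Defs "HOL-Library.Function_Algebras"
begin

text \<open>
  Let \<open>q = p ^ e\<close>, let \<open>S\<close> be the power series ring, and let \<open>M = M_i\<close> be generated by
  \<open>x^i\<close> and \<open>y^j\<close>, with \<open>i = i_t\<close> and \<open>j = j_t\<close>. Sorting the exponents of a series by their
  residues \<open>(u, v)\<close> modulo \<open>q\<close> splits the Frobenius twist of \<open>M\<close> into \<open>q^2\<close> summands: the series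
  supported on the exponents \<open>(u + q c, v + q d)\<close> become, after taking \<open>q\<close>-th roots of the
  coefficients, a copy of \<open>M_s\<close> with \<open>u + a v + q s \<equiv> i\<close> modulo \<open>n\<close>. Every class \<open>s\<close>
  arises from \<open>q^2 / n + O(q)\<close> pairs \<open>(u, v)\<close>. An \<open>R\<close>-linear map \<open>M_s \<rightarrow> M\<close> is multiplication
  by an element of \<open>M_{i-s}\<close>. Whether a map onto \<open>M^m\<close> is surjective is decided modulo the
  maximal ideal, where \<open>M\<close> becomes the plane spanned by \<open>x^i\<close> and \<open>y^j\<close>. The summand \<open>M_s\<close>
  reaches \<open>x^i\<close> exactly if \<open>s \<equiv> c\<close> with \<open>0 \<le> c \<le> i\<close>, and \<open>y^j\<close> exactly if
  \<open>s \<equiv> a d\<close> with \<open>0 \<le> d \<le> j\<close>. These classes are distinct, with two exceptions: \<open>c = d = 0\<close>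
  is the class of the cyclic module \<open>R\<close>, which fills one dimension only, in a direction of choice;
  \<open>(c, d) = (i, j)\<close> is the class of \<open>M\<close> itself, which fills two dimensions. Counting dimensions,
  the largest \<open>m\<close> is, up to \<open>O(q)\<close>, the minimum of \<open>i + 1\<close>, \<open>j + 1\<close> and \<open>(i + j + 1) / 2\<close>,
  times \<open>q^2 / n\<close>. If \<open>i \<noteq> j\<close> the minimum is \<open>min i j + 1\<close>; if \<open>i = j\<close> it is
  \<open>i + 1/2\<close>, half of the copies of \<open>R\<close> being needed on either side.

  The proof carries this out with coefficients and without decomposing modules. For the upper
  bound, \<open>twisted_hom_exchange\<close> takes the place of the description of the maps \<open>M_s \<rightarrow> M\<close>;
  it confines the monomials whose image can involve \<open>x^i\<close> or \<open>y^j\<close> to two boxes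
  (\<open>support_x\<close>, \<open>support_y\<close>), and \<open>twisted_surj_card_bound\<close> compares their number with the
  dimension to be filled. For the lower bound, \<open>twisted_surj_of_sources\<close> writes down a
  surjection from a matching of pairs \<open>(u, v)\<close>. Both bounds are collected in
  \<open>twisted_surj_number_bounds\<close>. The only input about continued fractions is
  \<open>series_corner_pair\<close>: \<open>(i_{t-1}, j_{t-1})\<close> and \<open>(i_t, j_t)\<close> form a basis of the lattice
  of all \<open>(b, d)\<close> with \<open>b \<equiv> a d\<close> modulo \<open>n\<close>.
\<close>

section \<open>Frobenius powers of power series\<close>

text \<open>As \<open>r ^ q\<close> has the coefficients \<open>r_i ^ q\<close> at the multiples of \<open>q\<close> and no others, the
  coefficients of \<open>g\<close> in different residue classes modulo \<open>q\<close> do not mix under multiplication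
  by \<open>r ^ q\<close>. The identity is over any commutative ring so that it can be used twice, for
  coefficients that are themselves power series and then for coefficients in the field.\<close>

lemma power_CHAR_mult_nth:
  fixes r g :: "'a::comm_ring_1 fps"
  assumes "prime CHAR('a)" and q: "q = CHAR('a) ^ e" and "u < q"
  shows "(r ^ q * g) $ (u + q * c) = (\<Sum>i\<le>c. (r $ i) ^ q * g $ (u + q * (c - i)))"
proof -
  define K N where "K = u + q * c" and "N = K + 1"
  define h where "h = fps_shift N r"
  have "prime CHAR('a fps)" using assms(1) by simp
  moreover have "q = CHAR('a fps) ^ e" using q by simp
  ultimately have frob: "(x + y) ^ q = x ^ q + y ^ q" "sum f A ^ q = (\<Sum>i\<in>A. f i ^ q)"
    for x y :: "'a fps" and f :: "nat \<Rightarrow> 'a fps" and A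
    by (auto intro: freshmans_dream' freshmans_dream_sum')
  have q0: "q > 0" using \<open>u < q\<close> by simp
  have cut: "fps_cutoff N r = (\<Sum>i<N. fps_const (r $ i) * fps_X ^ i)"
    by (simp add: fps_eq_iff fps_sum_nth fps_X_power_nth if_distrib cong: if_cong)
  \<comment> \<open>The freshman's dream is for finite sums; a tail beyond degree \<open>K\<close> is split off first.\<close>
  have "r ^ q = (fps_X ^ N * h + fps_cutoff N r) ^ q"
    by (simp add: h_def fps_shift_cutoff')
  also have "\<dots> = fps_X ^ (N * q) * h ^ q + (\<Sum>i<N. fps_const ((r $ i) ^ q) * fps_X ^ (i * q))"
    by (simp add: frob cut power_mult_distrib flip: power_mult)
  finally have "r ^ q * g = fps_X ^ (N * q) * (h ^ q * g)
      + (\<Sum>i<N. fps_const ((r $ i) ^ q) * (fps_X ^ (i * q) * g))"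
    by (simp add: algebra_simps sum_distrib_left)
  moreover have "K < N * q"
  proof -
    have "K * 1 \<le> K * q" using q0 by (intro mult_le_mono) auto
    thus ?thesis using q0 unfolding N_def distrib_right by linarith
  qed
  ultimately have "(r ^ q * g) $ K
      = (\<Sum>i<N. (r $ i) ^ q * (if K < i * q then 0 else g $ (K - i * q)))"
    by (simp add: fps_sum_nth fps_X_power_mult_nth)
  also have "\<dots> = (\<Sum>i\<le>c. (r $ i) ^ q * (if K < i * q then 0 else g $ (K - i * q)))"
  proof (rule sum.mono_neutral_right)
    have "1 * c \<le> q * c" using q0 by (intro mult_le_mono) auto
    hence "c < N" unfolding N_def K_def by linarith
    thus "{..c} \<subseteq> {..<N}" by auto
    have "K < i * q" if "\<not> i \<le> c" for i
    proof -
      have "(c + 1) * q \<le> i * q" using that by (intro mult_le_mono) auto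
      thus ?thesis using \<open>u < q\<close> unfolding K_def distrib_right mult.commute[of q] by linarith
    qed
    thus "\<forall>i\<in>{..<N} - {..c}. (r $ i) ^ q * (if K < i * q then 0 else g $ (K - i * q)) = 0"
      by simp
  qed simp
  also have "\<dots> = (\<Sum>i\<le>c. (r $ i) ^ q * g $ (u + q * (c - i)))"
  proof (rule sum.cong, rule refl)
    fix i assume "i \<in> {..c}"
    then obtain d where "c = i + d" using le_Suc_ex[of i c] by auto
    hence "\<not> K < i * q" "K - i * q = u + q * (c - i)" by (simp_all add: K_def distrib_left mult.commute[of q])
    thus "(r $ i) ^ q * (if K < i * q then 0 else g $ (K - i * q)) = (r $ i) ^ q * g $ (u + q * (c - i))"
      by simp
  qed
  finally show ?thesis by (simp add: K_def)
qed

lemma power_CHAR_bij: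
  fixes q :: nat
  assumes "prime CHAR('k::alg_closed_field)" and q: "q = CHAR('k) ^ e"
  shows "bij (\<lambda>x::'k. x ^ q)"
proof -
  have q0: "q > 0" using assms prime_gt_0_nat by auto
  have "x = y" if "x ^ q = y ^ q" for x y :: 'k
  proof -
    have "((x - y) + y) ^ q = (x - y) ^ q + y ^ q" by (rule freshmans_dream'[OF assms])
    hence "(x - y) ^ q = 0" using that by simp
    thus ?thesis by simp
  qed
  moreover have "\<exists>x. y = x ^ q" for y :: 'k using nth_root_exists[OF q0, of y] by metis
  ultimately show ?thesis by (auto simp: bij_def inj_def surj_def)
qed

section \<open>Monomials and isotypic components in two variables\<close>

definition mon :: "nat \<Rightarrow> nat \<Rightarrow> 'k::field fps fps" where
  "mon A B = fps_X ^ A * fps_const (fps_X ^ B)"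

lemma mon_nth: "mon A B $ i $ j = (if i = A \<and> j = B then 1 else (0 :: 'k::field))"
  by (auto simp: mon_def fps_X_power_mult_nth fps_X_power_nth)

lemma mon_mult_nth: "(mon A B * f) $ i $ j =
    (if A \<le> i \<and> B \<le> j then f $ (i - A) $ (j - B) else (0 :: 'k::field))"
  by (auto simp: mon_def fps_X_power_mult_nth mult.assoc)

lemma mon_add: "mon (A + C) (B + D) = mon A B * mon C D"
  by (simp add: mon_def power_add algebra_simps flip: fps_const_mult)

lemma mon_power: "mon A B ^ k = mon (k * A) (k * B)"
  by (simp add: mon_def power_mult_distrib mult.commute flip: power_mult)

lemma mon_0_0 [simp]: "mon 0 0 = 1"
  by (simp add: mon_def)

lemma mon_cancel: "mon A B * f = mon A B * g \<Longrightarrow> f = g"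
  by (simp add: mon_def)

definition cst :: "'k::field \<Rightarrow> 'k fps fps" where
  "cst c = fps_const (fps_const c)"

lemma cst_nth: "cst c $ i $ j = (if i = 0 \<and> j = 0 then c else 0)"
  by (simp add: cst_def fps_const_def)

lemma cst_mult_nth: "(cst c * f) $ i $ j = c * f $ i $ j"
  by (simp add: cst_def)

lemma cst_power: "cst c ^ k = cst (c ^ k)"
  by (simp add: cst_def)

text \<open>The carrier of \<open>M_t\<close>: the part of the power series ring on which the group acts through its
  \<open>t\<close>-th character. For \<open>t = 0\<close> it is the invariant ring.\<close>

definition isotypic :: "nat \<Rightarrow> nat \<Rightarrow> int \<Rightarrow> 'k::field fps fps set" where
  "isotypic n a t = {f. \<forall>i j. \<not> [int i + int j * int a = t] (mod int n) \<longrightarrow> f $ i $ j = 0}"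

lemma M_module_simps [simp]:
  "carrier (M_module n a t) = isotypic n a t"
  "zero (M_module n a t) = 0"
  "add (M_module n a t) = (+)"
  "smult (M_module n a t) = (*)"
  by (simp_all add: M_module_def isotypic_def)

lemma isotypic_I: "(\<And>i j. f $ i $ j \<noteq> 0 \<Longrightarrow> [int i + int j * int a = t] (mod int n)) \<Longrightarrow> f \<in> isotypic n a t"
  by (auto simp: isotypic_def)

lemma isotypic_D: "f \<in> isotypic n a t \<Longrightarrow> f $ i $ j \<noteq> 0 \<Longrightarrow> [int i + int j * int a = t] (mod int n)"
  by (auto simp: isotypic_def)

lemma isotypic_zero [simp]: "0 \<in> isotypic n a t"
  by (simp add: isotypic_def)

lemma isotypic_add: "f \<in> isotypic n a t \<Longrightarrow> g \<in> isotypic n a t \<Longrightarrow> f + g \<in> isotypic n a t"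
  by (auto simp: isotypic_def)

lemma isotypic_sum: "(\<And>x. x \<in> I \<Longrightarrow> f x \<in> isotypic n a t) \<Longrightarrow> sum f I \<in> isotypic n a t"
  by (induction I rule: infinite_finite_induct) (auto intro: isotypic_add)

lemma isotypic_cong: "[s = t] (mod int n) \<Longrightarrow> isotypic n a s = isotypic n a t"
  by (simp add: isotypic_def cong_def)

lemma mon_in_isotypic: "[int A + int B * int a = t] (mod int n) \<Longrightarrow> mon A B \<in> isotypic n a t"
  by (rule isotypic_I) (auto simp: mon_nth split: if_splits)

lemma cst_in_isotypic: "cst c \<in> isotypic n a 0"
  by (rule isotypic_I) (auto simp: cst_nth split: if_splits)

lemma fps2_mult_nth: "(f * g) $ i $ j = (\<Sum>k\<le>i. \<Sum>l\<le>j. f $ k $ l * g $ (i - k) $ (j - l))"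
  by (simp add: fps_mult_nth fps_sum_nth atLeast0AtMost)

lemma isotypic_mult:
  assumes "f \<in> isotypic n a s" and "g \<in> isotypic n a t"
  shows "f * g \<in> isotypic n a (s + t)"
proof (rule isotypic_I)
  fix i j assume "(f * g) $ i $ j \<noteq> 0"
  then obtain k l where "k \<le> i" "l \<le> j" and nz: "f $ k $ l \<noteq> 0" "g $ (i - k) $ (j - l) \<noteq> 0"
    unfolding fps2_mult_nth by (metis (no_types, lifting) atMost_iff mult_eq_0_iff sum.neutral)
  have "[(int k + int l * int a) + (int (i - k) + int (j - l) * int a) = s + t] (mod int n)"
    using nz assms by (intro cong_add isotypic_D)
  thus "[int i + int j * int a = s + t] (mod int n)"
    using \<open>k \<le> i\<close> \<open>l \<le> j\<close> by (simp add: of_nat_diff algebra_simps)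
qed

lemma isotypic_power: "f \<in> isotypic n a 0 \<Longrightarrow> f ^ k \<in> isotypic n a 0"
proof (induction k)
  case 0
  thus ?case using cst_in_isotypic[of 1 n a] by (simp add: cst_def)
next
  case (Suc k)
  thus ?case using isotypic_mult[of f n a 0 "f ^ k" 0] by simp
qed

lemma isotypic_power_mult: "r \<in> isotypic n a 0 \<Longrightarrow> g \<in> isotypic n a t \<Longrightarrow> r ^ k * g \<in> isotypic n a t"
  using isotypic_mult[OF isotypic_power, of r n a g t k] by simp

lemma power_eq_1_iff_primitive:
  assumes "primitive_root_of_unity n z"
  shows "z ^ m = 1 \<longleftrightarrow> n dvd m"
proof -
  have *: "0 < n" "z ^ n = 1" "\<And>m. 0 < m \<Longrightarrow> m < n \<Longrightarrow> z ^ m \<noteq> 1"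
    using assms by (auto simp: primitive_root_of_unity_def)
  have "z ^ m = z ^ (n * (m div n) + m mod n)" by simp
  also have "\<dots> = z ^ (m mod n)" unfolding power_add power_mult by (simp add: *)
  finally show ?thesis using * by (metis dvd_eq_mod_eq_0 gr_zeroI mod_less_divisor power_0)
qed

lemma carrier_invariant_ring:
  assumes z: "primitive_root_of_unity n z"
  shows "carrier (invariant_ring (cyclic_diag_group z a)) = isotypic n a 0"
proof -
  have act: "diag_act (z ^ m, (z ^ a) ^ m) f $ i $ j = (z ^ (i + j * a)) ^ m * f $ i $ j"
    for f m i j by (simp add: diag_act_def power_add power_mult_distrib mult_ac flip: power_mult)
  have cong: "[int i + int j * int a = 0] (mod int n) \<longleftrightarrow> n dvd i + j * a" for i j
    by (simp add: cong_0_iff flip: of_nat_mult of_nat_add)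
  \<comment> \<open>The generator of the group multiplies the monomial by \<open>z ^ (i + j * a)\<close>, which is \<open>1\<close> only in weight \<open>0\<close>.\<close>
  have "(\<forall>g\<in>cyclic_diag_group z a. diag_act g f = f) \<longleftrightarrow>
        (\<forall>m i j. (z ^ (i + j * a)) ^ m * f $ i $ j = f $ i $ j)" for f
    unfolding cyclic_diag_group_def fps_eq_iff[of "diag_act _ _"] act[symmetric]
    by (auto simp: fps_eq_iff)
  also have "\<dots> f \<longleftrightarrow> f \<in> isotypic n a 0" for f
  proof -
    have "f \<in> isotypic n a 0 \<longleftrightarrow> (\<forall>i j. z ^ (i + j * a) = 1 \<or> f $ i $ j = 0)"
      by (auto simp: isotypic_def cong power_eq_1_iff_primitive[OF z])
    also have "\<dots> \<longleftrightarrow> (\<forall>m i j. (z ^ (i + j * a)) ^ m * f $ i $ j = f $ i $ j)"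
    proof (intro iffI allI)
      fix m i j assume "\<forall>i j. z ^ (i + j * a) = 1 \<or> f $ i $ j = 0"
      thus "(z ^ (i + j * a)) ^ m * f $ i $ j = f $ i $ j" by (metis mult_1 mult_zero_right power_one)
    next
      fix i j assume "\<forall>m i j. (z ^ (i + j * a)) ^ m * f $ i $ j = f $ i $ j"
      hence "(z ^ (i + j * a)) ^ 1 * f $ i $ j = f $ i $ j" by blast
      thus "z ^ (i + j * a) = 1 \<or> f $ i $ j = 0" by auto
    qed
    finally show ?thesis by simp
  qed
  finally show ?thesis by (simp add: invariant_ring_def)
qed

lemma invariant_ring_pow: "r [^]\<^bsub>invariant_ring G\<^esub> (k :: nat) = r ^ k"
  by (induction k) (simp_all add: invariant_ring_def nat_pow_def mult.commute)

section \<open>Surjections from the Frobenius twist in coordinates\<close>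

text \<open>An \<open>R\<close>-linear map from the Frobenius twist of \<open>M_t\<close> to \<open>M_t\<close>, where \<open>q\<close> is the power of
  the characteristic. A map to the direct power is handled through its coordinates \<open>F g l\<close> for
  \<open>l < m\<close>, which avoids tuples that are only defined on an initial segment.\<close>

definition twisted_hom :: "nat \<Rightarrow> nat \<Rightarrow> int \<Rightarrow> nat \<Rightarrow> ('k::field fps fps \<Rightarrow> 'k fps fps) \<Rightarrow> bool" where
  "twisted_hom n a t q h \<longleftrightarrow> (\<forall>g\<in>isotypic n a t. h g \<in> isotypic n a t)
     \<and> (\<forall>g\<in>isotypic n a t. \<forall>g'\<in>isotypic n a t. h (g + g') = h g + h g')
     \<and> (\<forall>r\<in>isotypic n a 0. \<forall>g\<in>isotypic n a t. h (r ^ q * g) = r * h g)"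

definition twisted_surj :: "nat \<Rightarrow> nat \<Rightarrow> int \<Rightarrow> nat \<Rightarrow> nat \<Rightarrow> ('k::field fps fps \<Rightarrow> nat \<Rightarrow> 'k fps fps) \<Rightarrow> bool" where
  "twisted_surj n a t q m F \<longleftrightarrow> (\<forall>l<m. twisted_hom n a t q (\<lambda>g. F g l))
     \<and> (\<forall>w. (\<forall>l<m. w l \<in> isotypic n a t) \<longrightarrow> (\<exists>g\<in>isotypic n a t. \<forall>l<m. F g l = w l))"

lemma dual_F_number_eq:
  assumes z: "primitive_root_of_unity n (z :: 'k::field)"
  shows "dual_F_number (invariant_ring (cyclic_diag_group z a)) p (M_module n a t) e
    = Max {m. \<exists>F :: 'k fps fps \<Rightarrow> nat \<Rightarrow> 'k fps fps. twisted_surj n a t (p ^ e) m F}"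
proof -
  let ?R = "invariant_ring (cyclic_diag_group z a)" and ?q = "p ^ e"
  let ?E = "frobenius_twist ?R p e (M_module n a t :: (_, 'k fps fps) module)"
  let ?M = "direct_power (M_module n a t :: ('k fps fps, 'k fps fps) module)"
  have E: "carrier ?E = isotypic n a t" "add ?E = (+)" "smult ?E = (\<lambda>r x. r ^ ?q * x)"
    by (simp_all add: frobenius_twist_def invariant_ring_pow)
  have P: "carrier (?M m) = {..<m} \<rightarrow>\<^sub>E isotypic n a t"
      "add (?M m) = (\<lambda>f g. \<lambda>l\<in>{..<m}. f l + g l)"
      "smult (?M m) = (\<lambda>r f. \<lambda>l\<in>{..<m}. r * f l)" for m
    by (simp_all add: direct_power_def)
  have "(\<exists>f \<in> module_hom ?R ?E (?M m). f ` carrier ?E = carrier (?M m))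
      \<longleftrightarrow> (\<exists>F :: 'k fps fps \<Rightarrow> nat \<Rightarrow> 'k fps fps. twisted_surj n a t ?q m F)" (is "?L \<longleftrightarrow> ?S") for m
  proof
    assume ?L
    then obtain f where f: "f \<in> module_hom ?R ?E (?M m)" and s: "f ` isotypic n a t = {..<m} \<rightarrow>\<^sub>E isotypic n a t"
      unfolding E(1) P(1) by blast
    note f = f[unfolded module_hom_def mem_Collect_eq E P carrier_invariant_ring[OF z]]
    have "twisted_hom n a t ?q (\<lambda>g. f g l)" if "l < m" for l
      unfolding twisted_hom_def
    proof (intro conjI ballI)
      fix g :: "'k fps fps" assume "g \<in> isotypic n a t"
      hence "f g \<in> {..<m} \<rightarrow>\<^sub>E isotypic n a t" using s by blast
      thus "f g l \<in> isotypic n a t" using that by (simp add: PiE_iff)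
    next
      fix g h :: "'k fps fps" assume "g \<in> isotypic n a t" "h \<in> isotypic n a t"
      hence "f (g + h) = (\<lambda>l\<in>{..<m}. f g l + f h l)" using f by blast
      thus "f (g + h) l = f g l + f h l" using that by simp
    next
      fix r g :: "'k fps fps" assume "r \<in> isotypic n a 0" "g \<in> isotypic n a t"
      hence "f (r ^ ?q * g) = (\<lambda>l\<in>{..<m}. r * f g l)" using f by blast
      thus "f (r ^ ?q * g) l = r * f g l" using that by simp
    qed
    moreover have "\<exists>g\<in>isotypic n a t. \<forall>l<m. f g l = w l" if w: "\<forall>l<m. w l \<in> isotypic n a t" for w :: "nat \<Rightarrow> 'k fps fps"
    proof -
      have "(\<lambda>l\<in>{..<m}. w l) \<in> f ` isotypic n a t" unfolding s using w by simp
      then obtain g where "g \<in> isotypic n a t" "(\<lambda>l\<in>{..<m}. w l) = f g" by (rule imageE)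
      hence "f g l = w l" if "l < m" for l using that by (metis lessThan_iff restrict_apply')
      thus ?thesis using \<open>g \<in> _\<close> by blast
    qed
    ultimately show ?S unfolding twisted_surj_def by blast
  next
    assume ?S
    then obtain F :: "'k fps fps \<Rightarrow> nat \<Rightarrow> 'k fps fps" where F: "twisted_surj n a t ?q m F" ..
    define f where "f = (\<lambda>g. \<lambda>l\<in>{..<m}. F g l)"
    have h: "twisted_hom n a t ?q (\<lambda>g. F g l)" if "l < m" for l
      using F that by (simp add: twisted_surj_def)
    have fc: "f g \<in> {..<m} \<rightarrow>\<^sub>E isotypic n a t" if "g \<in> isotypic n a t" for g :: "'k fps fps"
      using h that by (simp add: f_def twisted_hom_def)
    have "f \<in> module_hom ?R ?E (?M m)"
      unfolding module_hom_def mem_Collect_eq E P carrier_invariant_ring[OF z]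
    proof (intro conjI ballI)
      fix g g' :: "'k fps fps" assume "g \<in> isotypic n a t" "g' \<in> isotypic n a t"
      thus "f (g + g') = (\<lambda>l\<in>{..<m}. f g l + f g' l)"
        using h by (intro ext) (simp add: f_def twisted_hom_def)
    next
      fix r g :: "'k fps fps" assume "r \<in> isotypic n a 0" "g \<in> isotypic n a t"
      thus "f (r ^ ?q * g) = (\<lambda>l\<in>{..<m}. r * f g l)"
        using h by (intro ext) (simp add: f_def twisted_hom_def)
    qed (use fc in blast)
    moreover have "w \<in> f ` isotypic n a t" if w: "w \<in> {..<m} \<rightarrow>\<^sub>E isotypic n a t" for w :: "nat \<Rightarrow> 'k fps fps"
    proof -
      have "\<forall>l<m. w l \<in> isotypic n a t" using w by (simp add: PiE_iff)
      then obtain g where g: "g \<in> isotypic n a t" "\<forall>l<m. F g l = w l"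
        using F unfolding twisted_surj_def by blast
      have "w = f g"
        unfolding f_def using g(2) PiE_arb[OF w] by (intro ext) simp
      thus ?thesis using g(1) by (rule image_eqI)
    qed
    ultimately show ?L
      unfolding E(1) P(1) using fc by (intro bexI[of _ f]) blast+
  qed
  thus ?thesis unfolding dual_F_number_def by simp
qed

section \<open>The corner cut out by the continued fraction\<close>

lemma hj_fraction_gt_1: "cs \<noteq> [] \<Longrightarrow> \<forall>c\<in>set cs. c \<ge> 2 \<Longrightarrow> hj_fraction cs > 1"
proof (induction cs rule: hj_fraction.induct)
  case (1 c)
  have "(of_int c :: rat) \<ge> of_int 2" using 1 by (subst of_int_le_iff) auto
  thus ?case by simp
next
  case (2 c d cs)
  have "(of_int c :: rat) \<ge> of_int 2" using 2 by (subst of_int_le_iff) auto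
  moreover have "1 / hj_fraction (d # cs) < 1" using 2 by simp
  ultimately show ?case by simp
qed auto

text \<open>The quotients \<open>i_t / i_{t+1}\<close> are the tails of the continued fraction. As these exceed \<open>1\<close>,
  the \<open>i\<close>-series decreases and stays positive.\<close>

lemma i_series_quotient:
  assumes "\<forall>c\<in>set cs. c \<ge> 2" and "hj_fraction cs = of_nat n / of_nat a" and "0 < a" and "t < length cs"
  shows "i_series n a cs (Suc t) > 0 \<and>
    hj_fraction (drop t cs) = of_int (i_series n a cs t) / of_int (i_series n a cs (Suc t))"
  using assms(4)
proof (induction t)
  case 0
  thus ?case using assms by simp
next
  case (Suc t)
  let ?i = "i_series n a cs"
  define x y z where "x = ?i t" and "y = ?i (Suc t)" and "z = ?i (Suc (Suc t))"
  define h where "h = hj_fraction (drop (Suc t) cs)"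
  have IH: "y > 0" "hj_fraction (drop t cs) = of_int x / of_int y"
    using Suc unfolding x_def y_def by auto
  have z: "z = cs ! t * y - x" by (simp add: x_def y_def z_def)
  have "h > 1" unfolding h_def using Suc.prems assms(1)
    by (intro hj_fraction_gt_1) (auto dest: in_set_dropD)
  obtain d ds where ds: "drop (Suc t) cs = d # ds"
    using Suc.prems by (metis Cons_nth_drop_Suc)
  have "drop t cs = cs ! t # d # ds" using Suc.prems ds by (metis Cons_nth_drop_Suc Suc_lessD)
  hence "of_int x / of_int y = of_int (cs ! t) - 1 / h" using IH ds h_def by simp
  hence zh: "of_int z * h = of_int y" using \<open>h > 1\<close> IH(1) unfolding z
    by (simp add: field_simps)
  moreover have "(0 :: rat) < of_int y" using IH(1) by simp
  ultimately have "(0::rat) < of_int z" using \<open>h > 1\<close> by (metis zero_less_mult_pos2 less_trans zero_less_one)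
  hence "z > 0" by simp
  moreover have "h = of_int y / of_int z" using zh \<open>(0::rat) < of_int z\<close> by (simp add: field_simps)
  ultimately show ?case unfolding h_def x_def y_def z_def by simp
qed

lemma series_det: "i_series n a cs t * j_series cs (Suc t) - i_series n a cs (Suc t) * j_series cs t = int n"
  by (induction t) (auto simp: algebra_simps)

lemma series_cong: "[i_series n a cs t = int a * j_series cs t] (mod int n)"
proof (induction n a cs t rule: i_series.induct)
  case (3 n a cs t)
  have "[cs ! t * i_series n a cs (Suc t) - i_series n a cs t
      = cs ! t * (int a * j_series cs (Suc t)) - int a * j_series cs t] (mod int n)"
    by (intro cong_diff cong_scalar_left 3)
  thus ?case by (simp add: algebra_simps)
qed (auto simp: cong_def)

lemma j_series_mono:
  assumes "\<forall>c\<in>set cs. c \<ge> 2" and "t \<le> length cs"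
  shows "0 \<le> j_series cs t \<and> j_series cs t < j_series cs (Suc t)"
  using assms(2)
proof (induction t)
  case (Suc t)
  have "cs ! t \<ge> 2" using assms(1) Suc.prems by simp
  hence "cs ! t * j_series cs (Suc t) \<ge> 2 * j_series cs (Suc t)"
    using Suc by (intro mult_right_mono) auto
  moreover have "0 \<le> j_series cs t \<and> j_series cs t < j_series cs (Suc t)" using Suc by simp
  ultimately show ?case unfolding j_series.simps by linarith
qed auto

text \<open>The vectors \<open>(i', j')\<close> and \<open>(i, j)\<close> have determinant \<open>n\<close>, which is the index of the lattice
  to which the divisibility conditions confine \<open>(b, B)\<close>; hence \<open>(b, B)\<close> is an integral
  combination \<open>u (i', j') + v (i, j)\<close>. With \<open>b = i (u + v) + (i' - i) u\<close> and
  \<open>B = j (u + v) - (j - j') u\<close>, the signs of \<open>u + v\<close> and \<open>u\<close> push one of the two coordinates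
  out of the box in each case.\<close>

lemma lattice_corner:
  fixes i i' j j' b B :: int
  assumes det: "i' * j - i * j' = n" and "n > 0"
    and "0 < i" "i < i'" "0 \<le> j'" "j' < j"
    and "n dvd b * j - B * i" "n dvd i' * B - j' * b"
    and b: "0 < b" "b \<le> i" "0 \<le> B" "B < j"
  shows False
proof -
  obtain u v where u: "b * j - B * i = n * u" and v: "i' * B - j' * b = n * v"
    using assms by (auto elim!: dvdE)
  have "n * (i' * u + i * v) = i' * (n * u) + i * (n * v)" by (simp add: algebra_simps)
  also have "\<dots> = n * b" unfolding u[symmetric] v[symmetric] unfolding det[symmetric] by (simp add: algebra_simps)
  finally have "n * b = n * (i' * u + i * v)" by (rule sym)
  hence beq: "b = i' * u + i * v" using \<open>n > 0\<close> by simp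
  have "n * (j' * u + j * v) = j' * (n * u) + j * (n * v)" by (simp add: algebra_simps)
  also have "\<dots> = n * B" unfolding u[symmetric] v[symmetric] unfolding det[symmetric] by (simp add: algebra_simps)
  finally have "n * B = n * (j' * u + j * v)" by (rule sym)
  hence Beq: "B = j' * u + j * v" using \<open>n > 0\<close> by simp
  show False
  proof (cases "u + v" "0 :: int" rule: linorder_cases)
    case equal
    hence "v = - u" by simp
    hence "b = (i' - i) * u" and Bneg: "B = - ((j - j') * u)" using beq Beq by (auto simp: algebra_simps)
    hence "u > 0" using b assms by (simp add: zero_less_mult_iff)
    hence "(j - j') * u > 0" using assms by simp
    thus False using Bneg b by simp
  next
    case less
    show False
    proof (cases "u > 0")
      case True
      have "B = j * (u + v) - (j - j') * u" unfolding Beq by (simp add: algebra_simps)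
      moreover have "j * (u + v) < 0" using less assms by (simp add: mult_less_0_iff)
      moreover have "(j - j') * u > 0" using True assms by simp
      ultimately show False using b by simp
    next
      case False
      have "b = i * (u + v) + (i' - i) * u" unfolding beq by (simp add: algebra_simps)
      moreover have "i * (u + v) < 0" using less assms by (simp add: mult_less_0_iff)
      moreover have "(i' - i) * u \<le> 0" using False assms by (simp add: mult_le_0_iff)
      ultimately show False using b by simp
    qed
  next
    case greater
    hence ge: "u + v \<ge> 1" by simp
    show False
    proof (cases "u > 0")
      case True
      have "b = i * (u + v) + (i' - i) * u" unfolding beq by (simp add: algebra_simps)
      moreover have "i * (u + v) \<ge> i * 1" using ge assms by (intro mult_left_mono) auto
      moreover have "(i' - i) * u > 0" using True assms by simp
      ultimately show False using b by simp
    next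
      case False
      have "B = j * (u + v) - (j - j') * u" unfolding Beq by (simp add: algebra_simps)
      moreover have "j * (u + v) \<ge> j * 1" using ge assms by (intro mult_left_mono) auto
      moreover have "(j - j') * u \<le> 0" using False assms by (simp add: mult_le_0_iff)
      ultimately show False using b by simp
    qed
  qed
qed

text \<open>What is used of \<open>i_t\<close> and \<open>j_t\<close>. The last clause says that every monomial of \<open>M_i\<close> is divisible
  by \<open>x^i\<close> or by \<open>y^j\<close>, so that these two generate \<open>M_i\<close>.\<close>

definition corner_pair :: "nat \<Rightarrow> nat \<Rightarrow> nat \<Rightarrow> nat \<Rightarrow> bool" where
  "corner_pair n a i j \<longleftrightarrow> coprime a n \<and> 0 < i \<and> i < n \<and> 0 < j \<and> j < n
     \<and> [int i = int j * int a] (mod int n)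
     \<and> (\<forall>A B. [int A + int B * int a = int i] (mod int n) \<longrightarrow> i \<le> A \<or> j \<le> B)"

lemma series_corner_pair:
  assumes "\<forall>c\<in>set cs. c \<ge> 2" and "hj_fraction cs = of_nat n / of_nat a"
    and "1 \<le> a" and "a \<le> n - 1" and "coprime a n" and "1 \<le> t" and "t \<le> length cs"
    and i: "i_series n a cs t = int i" and j: "j_series cs t = int j"
  shows "corner_pair n a i j"
proof -
  obtain s where s: "t = Suc s" using \<open>1 \<le> t\<close> by (cases t) auto
  define i' j' where "i' = i_series n a cs s" and "j' = j_series cs s"
  have n: "int n > 0" using assms by simp
  have I: "int i > 0" "hj_fraction (drop s cs) = of_int i' / of_nat i"
    using i_series_quotient[OF assms(1,2), of s] assms unfolding s i'_def by auto
  have "hj_fraction (drop s cs) > 1"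
    using assms s by (intro hj_fraction_gt_1) (auto dest: in_set_dropD)
  hence "(of_int i' :: rat) > of_int (int i)" using I by (simp add: field_simps)
  hence ii: "int i < i'" by (simp only: of_int_less_iff)
  have jj: "0 \<le> j'" "j' < int j" using j_series_mono[OF assms(1), of s] assms s j'_def by auto
  have det: "i' * int j - int i * j' = int n"
    using series_det[of n a cs s] i j s by (simp add: i'_def j'_def)
  have c: "[int i = int a * int j] (mod int n)" "[i' = int a * j'] (mod int n)"
    using series_cong[of n a cs t] series_cong[of n a cs s] i j s by (simp_all add: i'_def j'_def)
  have "int n > int j"
  proof -
    have "(int i + 1) * int j \<le> i' * int j" using ii by (intro mult_right_mono) auto
    moreover have "int i * (int j - j') > 0" using I jj by (intro mult_pos_pos) auto
    ultimately show ?thesis using det by (simp add: algebra_simps)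
  qed
  have "int i < int n"
  proof -
    have "int i * (j' + 1) \<le> int i * int j" using jj by (intro mult_left_mono) auto
    moreover have "(i' - int i) * int j > 0" using ii jj by (intro mult_pos_pos) auto
    ultimately show ?thesis using det by (simp add: algebra_simps)
  qed
  have "i \<le> A \<or> j \<le> B" if AB: "[int A + int B * int a = int i] (mod int n)" for A B
  proof (rule ccontr)
    assume nle: "\<not> (i \<le> A \<or> j \<le> B)"
    \<comment> \<open>Then \<open>(b, B)\<close> is a lattice point in the box excluded by \<open>lattice_corner\<close>.\<close>
    define b where "b = int i - int A"
    have b: "[b = int B * int a] (mod int n)"
      using AB by (simp add: b_def cong_iff_dvd_diff algebra_simps dvd_diff_commute)
    have "[b * int j - int B * int i = (int B * int a) * int j - int B * (int a * int j)] (mod int n)"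
      by (intro cong_diff cong_mult cong_refl b c)
    hence "int n dvd b * int j - int B * int i" by (simp add: cong_0_iff algebra_simps)
    moreover have "[i' * int B - j' * b = (int a * j') * int B - j' * (int B * int a)] (mod int n)"
      by (intro cong_diff cong_mult cong_refl b c)
    hence "int n dvd i' * int B - j' * b" by (simp add: cong_0_iff algebra_simps)
    ultimately show False
      using lattice_corner[OF det n _ ii jj, of b "int B"] I(1) nle by (auto simp: b_def)
  qed
  thus ?thesis unfolding corner_pair_def
    using I jj \<open>int n > int j\<close> \<open>int i < int n\<close> c assms by (auto simp: mult.commute)
qed

text \<open>The classes of \<open>x^0, ..., x^i\<close> and of \<open>y^0, ..., y^j\<close> meet in the two expected places only:
  if \<open>x^b\<close> and \<open>y^d\<close> have the same weight, then \<open>x^(i-b) y^d\<close> lies in \<open>M_i\<close> and is therefore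
  divisible by \<open>x^i\<close> or \<open>y^j\<close>.\<close>

lemma corner_pair_inj:
  assumes "corner_pair n a i j" and "b \<le> i" "d \<le> j" and "[int b = int d * int a] (mod int n)"
  shows "b = 0 \<and> d = 0 \<or> b = i \<and> d = j"
proof -
  note C = assms(1)[unfolded corner_pair_def]
  have inj: "x = y" if "[int x * int a = int y * int a] (mod int n)" "x < n" "y < n" for x y
  proof -
    have "[x * a = y * a] (mod n)" using that(1) by (simp flip: cong_int_iff)
    hence "[x = y] (mod n)" using C by (simp add: cong_mult_rcancel_nat)
    thus ?thesis using that(2,3) by (rule cong_less_modulus_unique_nat)
  qed
  have "[int (i - b) + int d * int a = int i] (mod int n)"
    using assms(2,4) by (simp add: of_nat_diff cong_iff_dvd_diff dvd_diff_commute algebra_simps)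
  hence "i \<le> i - b \<or> j \<le> d" using C by blast
  thus ?thesis
  proof
    assume "i \<le> i - b"
    hence "b = 0" using C assms by simp
    hence "d = 0" using inj[of 0 d] assms C by simp
    thus ?thesis using \<open>b = 0\<close> by simp
  next
    assume "j \<le> d"
    hence "d = j" using assms by simp
    hence "[int b = int i] (mod int n)" using C assms by (metis cong_sym cong_trans)
    hence "b = i" using C assms(2) cong_less_modulus_unique_nat[of b i n] by (simp add: cong_int_iff)
    thus ?thesis using \<open>d = j\<close> by simp
  qed
qed

section \<open>Counting lattice points in a rectangle\<close>

lemma card_cong_lessThan:
  fixes X n :: nat and c :: int
  assumes "0 < n"
  shows "X div n \<le> card {A. A < X \<and> [int A = c] (mod int n)}"
    and "card {A. A < X \<and> [int A = c] (mod int n)} \<le> X div n + 1"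
proof -
  define r where "r = nat (c mod int n)"
  have r: "r < n" "int r = c mod int n" using assms by (auto simp: r_def nat_less_iff)
  have iff: "[int A = c] (mod int n) \<longleftrightarrow> A mod n = r" for A
    unfolding cong_def r(2)[symmetric] by (simp flip: of_nat_mod)
  have "(\<lambda>k. r + n * k) ` {..<X div n} \<subseteq> {A. A < X \<and> A mod n = r}"
  proof safe
    fix k assume "k < X div n"
    hence "(k + 1) * n \<le> X div n * n" by (intro mult_le_mono) auto
    also have "\<dots> \<le> X" by simp
    finally show "r + n * k < X" using r by (simp add: algebra_simps)
  qed (use r in auto)
  hence "card ((\<lambda>k. r + n * k) ` {..<X div n}) \<le> card {A. A < X \<and> A mod n = r}"
    by (intro card_mono) auto
  moreover have "card ((\<lambda>k. r + n * k) ` {..<X div n}) = X div n"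
    using assms by (subst card_image) (auto simp: inj_on_def)
  ultimately show "X div n \<le> card {A. A < X \<and> [int A = c] (mod int n)}"
    unfolding iff by simp
  have "{A. A < X \<and> A mod n = r} \<subseteq> (\<lambda>k. r + n * k) ` {..X div n}"
  proof safe
    fix A assume "A < X" "r = A mod n"
    thus "A \<in> (\<lambda>k. A mod n + n * k) ` {..X div n}" by (intro image_eqI[of _ _ "A div n"]) (auto intro: div_le_mono)
  qed
  from surj_card_le[OF _ this] show "card {A. A < X \<and> [int A = c] (mod int n)} \<le> X div n + 1"
    unfolding iff by simp
qed

lemma card_cong_rectangle:
  fixes X n :: nat and c e :: int
  assumes "0 < n" and Y: "finite Y"
  shows "card Y * (X div n) \<le> card {(A, B). A < X \<and> B \<in> Y \<and> [int A + int B * e = c] (mod int n)}"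
    and "card {(A, B). A < X \<and> B \<in> Y \<and> [int A + int B * e = c] (mod int n)} \<le> card Y * (X div n + 1)"
proof -
  let ?S = "\<lambda>B. {A. A < X \<and> [int A = c - int B * e] (mod int n)}"
  have "{(A, B). A < X \<and> B \<in> Y \<and> [int A + int B * e = c] (mod int n)}
      = (\<lambda>(B, A). (A, B)) ` (SIGMA B:Y. ?S B)"
    by (force simp: cong_iff_dvd_diff algebra_simps)
  also have "card \<dots> = (\<Sum>B\<in>Y. card (?S B))"
    using Y by (subst card_image) (auto simp: inj_on_def card_SigmaI)
  finally have eq: "card {(A, B). A < X \<and> B \<in> Y \<and> [int A + int B * e = c] (mod int n)} = \<dots>" .
  show "card Y * (X div n) \<le> card {(A, B). A < X \<and> B \<in> Y \<and> [int A + int B * e = c] (mod int n)}"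
    unfolding eq using sum_bounded_below[of Y "X div n" "\<lambda>B. card (?S B)"] card_cong_lessThan(1)[OF \<open>0 < n\<close>] by simp
  show "card {(A, B). A < X \<and> B \<in> Y \<and> [int A + int B * e = c] (mod int n)} \<le> card Y * (X div n + 1)"
    unfolding eq using sum_bounded_above[of Y "\<lambda>B. card (?S B)" "X div n + 1"] card_cong_lessThan(2)[OF \<open>0 < n\<close>] by simp
qed

section \<open>The upper bound: monomials that reach the generators\<close>

lemma twisted_homD:
  assumes "twisted_hom n a t q h"
  shows "g \<in> isotypic n a t \<Longrightarrow> h g \<in> isotypic n a t"
    and "g \<in> isotypic n a t \<Longrightarrow> g' \<in> isotypic n a t \<Longrightarrow> h (g + g') = h g + h g'"
    and "r \<in> isotypic n a 0 \<Longrightarrow> g \<in> isotypic n a t \<Longrightarrow> h (r ^ q * g) = r * h g"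
  using assms by (auto simp: twisted_hom_def)

lemma mon_mem_isotypic_iff: "mon A B \<in> (isotypic n a t :: 'k::field fps fps set) \<longleftrightarrow> [int A + int B * int a = t] (mod int n)"
  using mon_in_isotypic isotypic_D[of "mon A B :: 'k fps fps" n a t A B] by (auto simp: mon_nth)

text \<open>The coordinate form of the fact that maps from \<open>M_s\<close> to \<open>M_t\<close> are multiplications: on the
  monomials with fixed residues \<open>(u, v)\<close>, the quotient of the image by \<open>x^c y^d\<close> is the same for
  all \<open>(c, d)\<close> of one class. Two invariant monomials with \<open>r x^c y^d = r' x^c' y^d'\<close> reduce this to
  \<open>R\<close>-linearity.\<close>

lemma twisted_hom_exchange:
  fixes h :: "'k::field fps fps \<Rightarrow> 'k fps fps"
  assumes h: "twisted_hom n a t q h" and "0 < n"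
    and m: "(mon (u + q * c) (v + q * d) :: 'k fps fps) \<in> isotypic n a t"
    and cong: "[int c + int d * int a = int c' + int d' * int a] (mod int n)"
  shows "mon c' d' * h (mon (u + q * c) (v + q * d)) = mon c d * h (mon (u + q * c') (v + q * d'))"
proof -
  obtain k where n: "n = Suc k" using \<open>0 < n\<close> by (cases n) auto
  define g g' where "g = (mon (u + q * c) (v + q * d) :: 'k fps fps)"
    and "g' = (mon (u + q * c') (v + q * d') :: 'k fps fps)"
  define r r' where "r = (mon (k * c + c') (k * d + d') :: 'k fps fps)"
    and "r' = (mon (n * c) (n * d) :: 'k fps fps)"
  have "[int q * (int c' + int d' * int a) = int q * (int c + int d * int a)] (mod int n)"
    using cong by (intro cong_mult cong_refl) (rule cong_sym)
  hence "[int (u + q * c') + int (v + q * d') * int a = int (u + q * c) + int (v + q * d) * int a] (mod int n)"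
    by (simp add: cong_iff_dvd_diff algebra_simps)
  hence g': "g' \<in> isotypic n a t" and g: "g \<in> isotypic n a t"
    using m unfolding g'_def g_def mon_mem_isotypic_iff by (auto intro: cong_trans)
  have "int (n * c) + int (n * d) * int a = int n * (int c + int d * int a)"
    by (simp add: algebra_simps)
  hence r': "r' \<in> isotypic n a 0" unfolding r'_def mon_mem_isotypic_iff by (simp add: cong_0_iff)
  have "[int (k * c + c') + int (k * d + d') * int a = int k * (int c + int d * int a) + (int c + int d * int a)] (mod int n)"
    using cong by (simp add: cong_iff_dvd_diff algebra_simps dvd_diff_commute)
  moreover have "int k * (int c + int d * int a) + (int c + int d * int a) = int n * (int c + int d * int a)"
    by (simp add: n algebra_simps)
  moreover have "[int n * (int c + int d * int a) = 0] (mod int n)" by (simp add: cong_0_iff)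
  ultimately have r: "r \<in> isotypic n a 0" unfolding r_def mon_mem_isotypic_iff by (metis cong_trans)
  have "r ^ q * g = r' ^ q * g'"
    unfolding r_def r'_def g_def g'_def mon_power mon_add[symmetric] n
    by (intro arg_cong2[of _ _ _ _ mon]) (simp_all add: algebra_simps)
  hence "r * h g = r' * h g'" using twisted_homD(3)[OF h] r r' g g' by metis
  moreover have "r = mon (k * c) (k * d) * mon c' d'" "r' = mon (k * c) (k * d) * mon c d"
    unfolding r_def r'_def mon_add[symmetric] n by (simp_all add: add.commute)
  ultimately show ?thesis
    using mon_cancel[of "k * c" "k * d"] unfolding g_def g'_def by (simp add: mult.assoc)
qed

text \<open>If the image of \<open>x^(u + q c) y^(v + q d)\<close> involves \<open>x^i\<close>, the exchange lemma makes
  \<open>x^(i + c') y^d'\<close> divisible by \<open>x^c y^d\<close> for every \<open>(c', d')\<close> of the same class as \<open>(c, d)\<close>.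
  Taking \<open>d' = 0\<close> gives \<open>d = 0\<close>, and taking \<open>c' = 0\<close> gives \<open>c \<le> i\<close>. The same two choices
  settle \<open>y^j\<close>.\<close>

lemma
  fixes h :: "'k::field fps fps \<Rightarrow> 'k fps fps"
  assumes h: "twisted_hom n a t q h" and "0 < n" "coprime a n" "0 < q"
    and m: "(mon A B :: 'k fps fps) \<in> isotypic n a t"
  shows support_x: "h (mon A B) $ i $ 0 \<noteq> 0 \<Longrightarrow> A < q * (i + 1) \<and> B < q"
    and support_y: "h (mon A B) $ 0 $ j \<noteq> 0 \<Longrightarrow> A < q \<and> B < q * (j + 1)"
proof -
  define u c v d where "u = A mod q" and "c = A div q" and "v = B mod q" and "d = B div q"
  have AB: "A = u + q * c" "B = v + q * d" "u < q" "v < q"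
    using \<open>0 < q\<close> by (auto simp: u_def c_def v_def d_def)
  have ex: "mon c' d' * h (mon A B) = mon c d * h (mon (u + q * c') (v + q * d'))"
    if "[int c + int d * int a = int c' + int d' * int a] (mod int n)" for c' d'
    using twisted_hom_exchange[OF h \<open>0 < n\<close> _ that] m unfolding AB by blast
  have le: "c \<le> x + c' \<and> d \<le> y + d'"
    if "h (mon A B) $ x $ y \<noteq> 0" "[int c + int d * int a = int c' + int d' * int a] (mod int n)"
    for x y c' d'
  proof -
    have "(mon c' d' * h (mon A B)) $ (x + c') $ (y + d') \<noteq> 0"
      using that by (simp add: mon_mult_nth)
    thus ?thesis unfolding ex[OF that(2)] by (simp add: mon_mult_nth split: if_splits)
  qed
  have hx: "[int c + int d * int a = int (c + d * a) + int 0 * int a] (mod int n)"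
    by simp
  obtain b where "[a * b = c + d * a] (mod n)"
    using \<open>coprime a n\<close> cong_solve_coprime_nat[of a n] by (metis cong_scalar_right mult.assoc mult_1 One_nat_def)
  hence hy: "[int c + int d * int a = int 0 + int b * int a] (mod int n)"
    by (simp add: cong_sym_eq mult.commute flip: cong_int_iff)
  have bound: "u + q * x < q * (y + 1)" if "x \<le> y" "u < q" for u x y
  proof -
    have "q * x \<le> q * y" using that by (intro mult_le_mono) auto
    thus ?thesis using that by (simp add: add_less_le_mono)
  qed
  show "A < q * (i + 1) \<and> B < q" if "h (mon A B) $ i $ 0 \<noteq> 0"
    using le[OF that hx] le[OF that hy] AB bound by auto
  show "A < q \<and> B < q * (j + 1)" if "h (mon A B) $ 0 $ j \<noteq> 0"
    using le[OF that hx] le[OF that hy] AB bound by auto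
qed

section \<open>The upper bound: comparing dimensions\<close>

lemma vector_space_functions: "vector_space (\<lambda>(c::'k::field) (f::'i \<Rightarrow> 'k) x. c * f x)"
  by unfold_locales (auto simp: fun_eq_iff algebra_simps)

definition unit_fun :: "'i \<Rightarrow> 'i \<Rightarrow> 'k::field" where
  "unit_fun x = (\<lambda>y. if y = x then 1 else 0)"

lemma card_le_of_unit_funs_in_span:
  fixes V :: "('i \<Rightarrow> 'k::field) set"
  assumes "finite V" and "finite E"
    and sp: "\<And>x. x \<in> E \<Longrightarrow> unit_fun x \<in> module.span (\<lambda>c f x. c * f x) V"
  shows "card E \<le> card V"
proof -
  interpret vector_space "\<lambda>(c::'k) (f::'i \<Rightarrow> 'k) x. c * f x" by (rule vector_space_functions)
  have inj: "inj_on (unit_fun :: 'i \<Rightarrow> 'i \<Rightarrow> 'k) E"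
    by (rule inj_onI) (metis unit_fun_def zero_neq_one)
  have "independent ((unit_fun :: 'i \<Rightarrow> 'i \<Rightarrow> 'k) ` E)"
    unfolding independent_explicit_finite_subsets
  proof (intro allI impI ballI)
    fix S u v assume S: "S \<subseteq> unit_fun ` E" "finite S"
      and sum0: "(\<Sum>v\<in>S. (\<lambda>x. u v * v x)) = (0 :: 'i \<Rightarrow> 'k)" and v: "v \<in> S"
    obtain x where x: "v = unit_fun x" "x \<in> E" using S v by auto
    have "(\<Sum>w\<in>S. u w * w x) = (\<Sum>w\<in>S. if w = v then u v else 0)"
    proof (rule sum.cong, rule refl)
      fix w assume "w \<in> S"
      then obtain y where y: "w = unit_fun y" "y \<in> E" using S by auto
      show "u w * w x = (if w = v then u v else 0)"
        using inj_on_eq_iff[OF inj y(2) x(2)] unfolding x y by (auto simp: unit_fun_def)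
    qed
    moreover have "(\<Sum>w\<in>S. (\<lambda>x. u w * w x)) x = (\<Sum>w\<in>S. u w * w x)"
      using S(2) by (induction S rule: finite_induct) auto
    ultimately show "u v = 0" using sum0 S v by simp
  qed
  from independent_span_bound[OF assms(1) this] sp have "card ((unit_fun :: 'i \<Rightarrow> 'i \<Rightarrow> 'k) ` E) \<le> card V"
    by blast
  thus ?thesis by (simp add: card_image[OF inj])
qed

text \<open>Here \<open>K\<close> is a set of exponents below \<open>n\<close>, and the coefficients at \<open>K\<close> of the \<open>m\<close> coordinates
  give a map onto a space of dimension \<open>m * card K\<close>. Its image is spanned by the images of
  monomials: the multiples of \<open>x^(q n)\<close> and \<open>y^(q n)\<close> are mapped to multiples of \<open>x^n\<close> and
  \<open>y^n\<close>, which have no coefficient at \<open>K\<close>, and what remains of a series is a polynomial. As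
  coefficients have \<open>q\<close>-th roots, linearity over constants survives the twist.\<close>

lemma twisted_surj_card_bound:
  fixes F :: "'k::alg_closed_field fps fps \<Rightarrow> nat \<Rightarrow> 'k fps fps"
  assumes F: "twisted_surj n a t q m F" and "0 < n" "0 < q"
    and K: "finite K" "\<And>x. x \<in> K \<Longrightarrow> fst x < n \<and> snd x < n \<and> mon (fst x) (snd x) \<in> (isotypic n a t :: 'k fps fps set)"
    and T: "finite T" "\<And>A B l x. mon A B \<in> (isotypic n a t :: 'k fps fps set) \<Longrightarrow> l < m \<Longrightarrow> x \<in> K \<Longrightarrow>
        F (mon A B) l $ fst x $ snd x \<noteq> 0 \<Longrightarrow> (A, B) \<in> T"
  shows "m * card K \<le> card T"
proof -
  define \<phi> where "\<phi> g = (\<lambda>y. if y \<in> {..<m} \<times> K then F g (fst y) $ fst (snd y) $ snd (snd y) else 0)" for g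
  define V where "V = (\<lambda>(A, B). \<phi> (mon A B)) ` T"
  interpret vector_space "\<lambda>(c::'k) (f::nat \<times> nat \<times> nat \<Rightarrow> 'k) x. c * f x" by (rule vector_space_functions)
  have hom: "twisted_hom n a t q (\<lambda>g. F g l)" if "l < m" for l
    using F that by (simp add: twisted_surj_def)
  have \<phi>_add: "\<phi> (g + g') = \<phi> g + \<phi> g'" if "g \<in> isotypic n a t" "g' \<in> isotypic n a t" for g g'
    unfolding \<phi>_def using twisted_homD(2)[OF hom that] by (auto simp: fun_eq_iff)
  have \<phi>_mult: "\<phi> (r ^ q * g) = (\<lambda>y. if y \<in> {..<m} \<times> K then (r * F g (fst y)) $ fst (snd y) $ snd (snd y) else 0)"
    if "r \<in> isotypic n a 0" "g \<in> isotypic n a t" for r g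
    unfolding \<phi>_def using twisted_homD(3)[OF hom that] by (auto simp: fun_eq_iff)
  have \<phi>_mon: "\<phi> (mon A B) \<in> span V" if "mon A B \<in> (isotypic n a t :: 'k fps fps set)" for A B
  proof (cases "(A, B) \<in> T")
    case True
    thus ?thesis unfolding V_def by (intro span_base) auto
  next
    case False
    hence "\<phi> (mon A B) = 0" unfolding \<phi>_def using T(2)[OF that] by (intro ext) force
    thus ?thesis by (simp add: span_zero)
  qed
  have \<phi>_term: "\<phi> (cst b * mon A B) \<in> span V" if m: "mon A B \<in> (isotypic n a t :: 'k fps fps set)" for b A B
  proof -
    obtain r where r: "r ^ q = b" using nth_root_exists[OF \<open>0 < q\<close>] by blast
    have "\<phi> (cst b * mon A B) = (\<lambda>y. r * \<phi> (mon A B) y)"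
      using \<phi>_mult[OF cst_in_isotypic m, of r] by (auto simp: cst_power r cst_mult_nth \<phi>_def)
    thus ?thesis using span_scale[OF \<phi>_mon[OF m], of r] by simp
  qed
  have "\<phi> 0 + \<phi> 0 = \<phi> 0" using \<phi>_add[of 0 0] by simp
  hence \<phi>_zero: "\<phi> 0 = 0" by (metis add_cancel_left_left)
  have span: "\<phi> g \<in> span V" if g: "g \<in> isotypic n a t" for g
  proof -
    define N where "N = q * n"
    define I where "I = {(A, B). A < N \<and> B < N \<and> [int A + int B * int a = t] (mod int n)}"
    have "finite I" by (rule finite_subset[of _ "{..<N} \<times> {..<N}"]) (auto simp: I_def)
    define P where "P = (\<Sum>(A, B)\<in>I. cst (g $ A $ B) * mon A B)"
    \<comment> \<open>\<open>P\<close> collects the exponents below \<open>N\<close>; the rest is \<open>x^N g1 + y^N g2\<close>.\<close>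
    define g1 where "g1 = Abs_fps (\<lambda>A. Abs_fps (\<lambda>B. g $ (A + N) $ B))"
    define g2 where "g2 = Abs_fps (\<lambda>A. Abs_fps (\<lambda>B. if A < N then g $ A $ (B + N) else 0))"
    have "P \<in> isotypic n a t \<and> \<phi> P \<in> span V"
    proof -
      have "(\<Sum>(A, B)\<in>J. cst (g $ A $ B) * mon A B) \<in> isotypic n a t \<and>
          \<phi> (\<Sum>(A, B)\<in>J. cst (g $ A $ B) * mon A B) \<in> span V" if "finite J" "J \<subseteq> I" for J
        using that
      proof (induction J rule: finite_induct)
        case (insert x J)
        obtain A B where x: "x = (A, B)" by force
        have m: "(mon A B :: 'k fps fps) \<in> isotypic n a t" using insert x by (simp add: mon_mem_isotypic_iff I_def)
        have "cst (g $ A $ B) * mon A B \<in> isotypic n a (0 + t)" by (intro isotypic_mult cst_in_isotypic m)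
        hence s: "cst (g $ A $ B) * mon A B \<in> isotypic n a t" by simp
        have IH: "(\<Sum>(A, B)\<in>J. cst (g $ A $ B) * mon A B) \<in> isotypic n a t"
          "\<phi> (\<Sum>(A, B)\<in>J. cst (g $ A $ B) * mon A B) \<in> span V"
          using insert by auto
        have eq: "(\<Sum>(A, B)\<in>insert x J. cst (g $ A $ B) * mon A B)
            = cst (g $ A $ B) * mon A B + (\<Sum>(A, B)\<in>J. cst (g $ A $ B) * mon A B)"
          using insert(1,2) by (simp add: x)
        show ?case unfolding eq \<phi>_add[OF s IH(1)]
          by (intro conjI isotypic_add s IH(1) span_add[OF \<phi>_term[OF m] IH(2)])
      qed (simp add: \<phi>_zero span_zero)
      thus ?thesis unfolding P_def using \<open>finite I\<close> by blast
    qed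
    moreover have g1: "g1 \<in> isotypic n a t"
    proof (rule isotypic_I)
      fix A B assume "g1 $ A $ B \<noteq> 0"
      hence "[int (A + N) + int B * int a = t] (mod int n)" unfolding g1_def by (intro isotypic_D[OF g]) simp
      moreover have "[int (A + N) + int B * int a = int A + int B * int a] (mod int n)"
        by (simp add: N_def cong_iff_dvd_diff)
      ultimately show "[int A + int B * int a = t] (mod int n)" using cong_sym cong_trans by blast
    qed
    moreover have g2: "g2 \<in> isotypic n a t"
    proof (rule isotypic_I)
      fix A B assume "g2 $ A $ B \<noteq> 0"
      hence "g $ A $ (B + N) \<noteq> 0" by (simp add: g2_def split: if_splits)
      hence "[int A + int (B + N) * int a = t] (mod int n)" by (rule isotypic_D[OF g])
      moreover have "[int A + int (B + N) * int a = int A + int B * int a] (mod int n)"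
        by (simp add: N_def cong_iff_dvd_diff algebra_simps)
      ultimately show "[int A + int B * int a = t] (mod int n)" using cong_sym cong_trans by blast
    qed
    moreover have xn: "(mon n 0 :: 'k fps fps) \<in> isotypic n a 0" "(mon 0 n :: 'k fps fps) \<in> isotypic n a 0"
      by (simp_all add: mon_mem_isotypic_iff cong_0_iff)
    have "\<phi> (mon n 0 ^ q * g1) = 0" "\<phi> (mon 0 n ^ q * g2) = 0"
      unfolding \<phi>_mult[OF xn(1) g1] \<phi>_mult[OF xn(2) g2] using K(2) by (force simp: fun_eq_iff mon_mult_nth)+
    moreover have "mon n 0 ^ q * g1 \<in> isotypic n a t" "mon 0 n ^ q * g2 \<in> isotypic n a t"
      by (intro isotypic_power_mult xn g1 g2)+
    moreover have "g = P + (mon n 0 ^ q * g1 + mon 0 n ^ q * g2)"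
    proof -
      have P: "P $ A $ B = (if A < N \<and> B < N then g $ A $ B else 0)" for A B
      proof -
        have "P $ A $ B = (\<Sum>x\<in>I. if x = (A, B) then g $ A $ B else 0)"
          unfolding P_def by (simp add: fps_sum_nth split_def) (rule sum.cong, auto simp: cst_mult_nth mon_nth)
        also have "\<dots> = (if (A, B) \<in> I then g $ A $ B else 0)" using \<open>finite I\<close> by simp
        finally show ?thesis using isotypic_D[OF g, of A B] by (auto simp: I_def)
      qed
      show ?thesis unfolding fps_eq_iff mon_power
        by (auto simp: P mon_mult_nth g1_def g2_def N_def)
    qed
    ultimately show ?thesis by (simp add: \<phi>_add isotypic_add)
  qed
  have "card ({..<m} \<times> K) \<le> card V"
  proof (rule card_le_of_unit_funs_in_span)
    fix x assume x: "x \<in> {..<m} \<times> K"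
    obtain l A B where lAB: "x = (l, A, B)" by (cases x) auto
    define w :: "nat \<Rightarrow> 'k fps fps" where "w = (\<lambda>l'. if l' = l then mon A B else 0)"
    have "\<forall>l<m. w l \<in> isotypic n a t" using K(2)[of "(A, B)"] x lAB by (auto simp: w_def)
    then obtain g where g: "g \<in> isotypic n a t" "\<forall>l<m. F g l = w l"
      using F unfolding twisted_surj_def by blast
    have "\<phi> g = unit_fun x"
      unfolding \<phi>_def unit_fun_def using g x lAB by (auto simp: fun_eq_iff w_def mon_nth)
    thus "unit_fun x \<in> span V" using span[OF g(1)] by simp
  qed (use T K in \<open>auto simp: V_def\<close>)
  also have "card V \<le> card T" unfolding V_def using T(1) by (rule card_image_le)
  finally show ?thesis by (simp add: card_cartesian_product)
qed

section \<open>Slices of a power series along residues of exponents\<close>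

text \<open>The pairs of residues \<open>(u, v)\<close> whose slice of \<open>M_t\<close> is a copy of \<open>M_s\<close>.\<close>

definition source :: "nat \<Rightarrow> nat \<Rightarrow> nat \<Rightarrow> int \<Rightarrow> int \<Rightarrow> (nat \<times> nat) set" where
  "source q n a t s = {(u, v). u < q \<and> v \<in> {..<q} \<and> [int u + int v * int a = t - int q * s] (mod int n)}"

lemma sourceD:
  assumes "z \<in> source q n a t s"
  shows "z \<in> {..<q} \<times> {..<q}" "[int (fst z) + int (snd z) * int a + int q * s = t] (mod int n)"
  using assms by (auto simp: source_def cong_iff_dvd_diff algebra_simps)

lemma source_disjoint:
  assumes "coprime q n" and "z \<in> source q n a t s" and "z \<in> source q n a t s'"
  shows "[s = s'] (mod int n)"
proof -
  have "[int (fst z) + int (snd z) * int a + int q * s = int (fst z) + int (snd z) * int a + int q * s'] (mod int n)"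
    using sourceD(2)[OF assms(2)] sourceD(2)[OF assms(3)] cong_sym cong_trans by blast
  hence "[int q * s = int q * s'] (mod int n)" by (simp add: cong_add_lcancel)
  thus ?thesis using assms(1) by (simp add: cong_mult_lcancel)
qed

lemma source_finite: "finite (source q n a t s)"
  by (rule finite_subset[of _ "{..<q} \<times> {..<q}"]) (auto simp: source_def)

lemma source_card: "0 < n \<Longrightarrow> q * (q div n) \<le> card (source q n a t s)"
  using card_cong_rectangle(1)[of n "{..<q}" q "int a" "t - int q * s"] by (simp add: source_def)

text \<open>The projection of the Frobenius twist to its summand with residues \<open>z = (u, v)\<close>. Extracting
  \<open>q\<close>-th roots of the coefficients makes it linear over the power series ring in the sense of
  \<open>slice_power_mult\<close>.\<close>

definition slice :: "nat \<Rightarrow> nat \<times> nat \<Rightarrow> 'k::alg_closed_field fps fps \<Rightarrow> 'k fps fps" where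
  "slice q z g = Abs_fps (\<lambda>c. Abs_fps (\<lambda>d. inv_into UNIV (\<lambda>x. x ^ q) (g $ (fst z + q * c) $ (snd z + q * d))))"

context
  fixes q e :: nat
  assumes char: "prime CHAR('k::alg_closed_field)" and q: "q = CHAR('k) ^ e"
begin

lemma q_pos: "q > 0"
  using char q prime_gt_0_nat by auto

lemma qroot_power: "inv_into UNIV (\<lambda>x::'k. x ^ q) y ^ q = y"
  using power_CHAR_bij[OF char q] by (metis (mono_tags) bij_def surj_f_inv_f)

lemma slice_nth_power: "(slice q z (g :: 'k fps fps) $ c $ d) ^ q = g $ (fst z + q * c) $ (snd z + q * d)"
  by (simp add: slice_def qroot_power)

lemma power_q_inj: "x ^ q = y ^ q \<longleftrightarrow> x = (y :: 'k)"
  using power_CHAR_bij[OF char q] by (auto simp: bij_def inj_def)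

lemma slice_eqI:
  fixes f g :: "'k fps fps"
  assumes "\<And>c d. (f $ c $ d) ^ q = g $ (fst z + q * c) $ (snd z + q * d)"
  shows "slice q z g = f"
  unfolding fps_eq_iff by (metis assms power_q_inj slice_nth_power)

lemma slice_zero: "slice q z (0 :: 'k fps fps) = 0"
  by (rule slice_eqI) (simp add: q_pos)

lemma slice_add: "slice q z (f + g :: 'k fps fps) = slice q z f + slice q z g"
  by (rule slice_eqI) (simp add: freshmans_dream'[OF char q] slice_nth_power)

lemma slice_sum: "slice q z (sum f I :: 'k fps fps) = (\<Sum>x\<in>I. slice q z (f x))"
  by (induction I rule: infinite_finite_induct) (auto simp: slice_zero slice_add)

lemma slice_power_mult:
  fixes r g :: "'k fps fps"
  assumes z: "z \<in> {..<q} \<times> {..<q}"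
  shows "slice q z (r ^ q * g) = r * slice q z g"
proof (rule slice_eqI)
  fix c d
  obtain u v where uv: "z = (u, v)" "u < q" "v < q" using z by auto
  have "(r ^ q * g) $ (u + q * c) = (\<Sum>i\<le>c. (r $ i) ^ q * g $ (u + q * (c - i)))"
    by (rule power_CHAR_mult_nth[of q e]) (use char q uv in auto)
  hence "(r ^ q * g) $ (u + q * c) $ (v + q * d)
      = (\<Sum>i\<le>c. ((r $ i) ^ q * g $ (u + q * (c - i))) $ (v + q * d))"
    by (simp only: fps_sum_nth)
  also have "\<dots> = (\<Sum>i\<le>c. \<Sum>j\<le>d. (r $ i $ j) ^ q * g $ (u + q * (c - i)) $ (v + q * (d - j)))"
    by (intro sum.cong refl power_CHAR_mult_nth[OF char q]) (use uv in auto)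
  also have "\<dots> = (\<Sum>i\<le>c. \<Sum>j\<le>d. (r $ i $ j * slice q z g $ (c - i) $ (d - j)) ^ q)"
    by (simp add: power_mult_distrib slice_nth_power uv)
  also have "\<dots> = ((r * slice q z g) $ c $ d) ^ q"
    by (simp add: fps2_mult_nth freshmans_dream_sum'[OF char q])
  finally show "((r * slice q z g) $ c $ d) ^ q = (r ^ q * g) $ (fst z + q * c) $ (snd z + q * d)"
    by (simp add: uv)
qed

lemma slice_mon:
  assumes "z \<in> {..<q} \<times> {..<q}" and "z' \<in> {..<q} \<times> {..<q}"
  shows "slice q z (mon (fst z' + q * c) (snd z' + q * d)) = (if z = z' then mon c d else 0 :: 'k fps fps)"
proof (rule slice_eqI)
  fix c' d'
  have *: "u + q * x = u' + q * y \<longleftrightarrow> u = u' \<and> x = y" if "u < q" "u' < q" for u u' x y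
    using that by (metis add_left_cancel mod_less mod_mult_self2 mult_cancel1 not_less_zero)
  show "((if z = z' then mon c d else 0 :: 'k fps fps) $ c' $ d') ^ q
      = mon (fst z' + q * c) (snd z' + q * d) $ (fst z + q * c') $ (snd z + q * d')"
    using assms q_pos by (auto simp: mon_nth *)
qed

lemma slice_isotypic:
  assumes g: "(g :: 'k fps fps) \<in> isotypic n a t" and "coprime q n"
    and z: "[int (fst z) + int (snd z) * int a + int q * s = t] (mod int n)"
  shows "slice q z g \<in> isotypic n a s"
proof (rule isotypic_I)
  fix c d assume "slice q z g $ c $ d \<noteq> 0"
  hence "g $ (fst z + q * c) $ (snd z + q * d) \<noteq> 0"
    using slice_nth_power[of z g c d] by auto
  from isotypic_D[OF g this]
  have "[int (fst z + q * c) + int (snd z + q * d) * int a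
      = int (fst z) + int (snd z) * int a + int q * s] (mod int n)"
    using z cong_sym cong_trans by blast
  hence "[int q * (int c + int d * int a) = int q * s] (mod int n)"
    by (simp add: cong_iff_dvd_diff algebra_simps)
  thus "[int c + int d * int a = s] (mod int n)"
    using \<open>coprime q n\<close> by (simp add: cong_mult_lcancel)
qed

text \<open>The multiples of \<open>x^i\<close> are split off first; by the last clause of \<open>corner_pair\<close>, the
  remaining monomials are multiples of \<open>y^j\<close>.\<close>

lemma corner_decompose:
  assumes C: "corner_pair n a i j" and f: "(f :: 'k fps fps) \<in> isotypic n a (int i)"
  obtains \<alpha> \<beta> where "\<alpha> \<in> isotypic n a 0" "\<beta> \<in> isotypic n a 0" "f = mon i 0 * \<alpha> + mon 0 j * \<beta>"
proof
  define \<alpha> where "\<alpha> = Abs_fps (\<lambda>A. Abs_fps (\<lambda>B. f $ (A + i) $ B))"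
  define \<beta> where "\<beta> = Abs_fps (\<lambda>A. Abs_fps (\<lambda>B. if A < i then f $ A $ (B + j) else 0))"
  have ij: "[int i = int j * int a] (mod int n)" using C by (simp add: corner_pair_def)
  show "\<alpha> \<in> isotypic n a 0"
  proof (rule isotypic_I)
    fix A B assume "\<alpha> $ A $ B \<noteq> 0"
    hence "[int (A + i) + int B * int a = int i] (mod int n)"
      unfolding \<alpha>_def by (intro isotypic_D[OF f]) simp
    thus "[int A + int B * int a = 0] (mod int n)" by (simp add: cong_iff_dvd_diff algebra_simps)
  qed
  show "\<beta> \<in> isotypic n a 0"
  proof (rule isotypic_I)
    fix A B assume "\<beta> $ A $ B \<noteq> 0"
    hence "f $ A $ (B + j) \<noteq> 0" unfolding \<beta>_def by (simp split: if_splits)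
    hence "[int A + int (B + j) * int a = int i] (mod int n)" by (rule isotypic_D[OF f])
    from cong_trans[OF this ij] show "[int A + int B * int a = 0] (mod int n)"
      by (simp add: cong_iff_dvd_diff algebra_simps)
  qed
  have "f $ A $ B = 0" if "A < i" "B < j" for A B
  proof (rule ccontr)
    assume "f $ A $ B \<noteq> 0"
    from isotypic_D[OF f this] show False using C that unfolding corner_pair_def by (metis not_le)
  qed
  thus "f = mon i 0 * \<alpha> + mon 0 j * \<beta>"
    unfolding fps_eq_iff by (auto simp: mon_mult_nth \<alpha>_def \<beta>_def not_le)
qed

text \<open>The \<open>l\<close>-th copy of \<open>M_i\<close> receives \<open>x^i\<close> from the slice \<open>xs l\<close>, a copy of \<open>M_c\<close> containing
  \<open>x^c\<close>, through multiplication by \<open>x^(i-c)\<close>; likewise it receives \<open>y^j\<close> from the slice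
  \<open>ys l\<close>. A slice may serve both purposes only if it is a copy of \<open>M_i\<close>, and then for the same
  \<open>l\<close>; this is the last assumption. Since no other slice is shared, the preimage of a tuple can be
  assembled from the generators of the individual slices.\<close>

lemma twisted_surj_of_sources:
  fixes xs ys :: "nat \<Rightarrow> nat \<times> nat" and cx dy :: "nat \<Rightarrow> nat"
  assumes C: "corner_pair n a i j" and cop: "coprime q n"
    and xs: "\<And>l. l < m \<Longrightarrow> xs l \<in> source q n a (int i) (int (cx l))" and cx: "\<And>l. l < m \<Longrightarrow> cx l \<le> i"
    and ys: "\<And>l. l < m \<Longrightarrow> ys l \<in> source q n a (int i) (int (dy l) * int a)" and dy: "\<And>l. l < m \<Longrightarrow> dy l \<le> j"
    and ix: "inj_on xs {..<m}" and iy: "inj_on ys {..<m}"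
    and eq: "\<And>l l'. l < m \<Longrightarrow> l' < m \<Longrightarrow> xs l = ys l' \<Longrightarrow> l = l' \<and> cx l = i \<and> dy l = j"
  shows "\<exists>F :: 'k fps fps \<Rightarrow> nat \<Rightarrow> 'k fps fps. twisted_surj n a (int i) q m F"
proof -
  define F :: "'k fps fps \<Rightarrow> nat \<Rightarrow> 'k fps fps" where
    "F g l = mon (i - cx l) 0 * slice q (xs l) g
      + (if xs l = ys l then 0 else mon 0 (j - dy l) * slice q (ys l) g)" for g l
  have ij: "[int j * int a = int i] (mod int n)" using C by (simp add: corner_pair_def cong_sym)
  note X = sourceD[OF xs] and Y = sourceD[OF ys]
  have hom: "twisted_hom n a (int i) q (\<lambda>g. F g l)" if l: "l < m" for l
    unfolding twisted_hom_def
  proof (intro conjI ballI)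
    fix g :: "'k fps fps" assume g: "g \<in> isotypic n a (int i)"
    have "mon (i - cx l) 0 * slice q (xs l) g \<in> isotypic n a (int (i - cx l) + int (cx l))"
      using X(2)[OF l] by (intro isotypic_mult mon_in_isotypic slice_isotypic[OF g cop]) auto
    moreover have "mon 0 (j - dy l) * slice q (ys l) g \<in> isotypic n a (int (j - dy l) * int a + int (dy l) * int a)"
      using Y(2)[OF l] by (intro isotypic_mult mon_in_isotypic slice_isotypic[OF g cop]) auto
    moreover have "int (j - dy l) * int a + int (dy l) * int a = int j * int a"
      using dy[OF l] by (simp add: of_nat_diff algebra_simps)
    ultimately show "F g l \<in> isotypic n a (int i)"
      unfolding F_def using cx[OF l] isotypic_cong[OF ij, where 'a = 'k, of a]
      by (intro isotypic_add) (auto simp: of_nat_diff)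
  next
    fix g g' :: "'k fps fps"
    show "F (g + g') l = F g l + F g' l" by (simp add: F_def slice_add algebra_simps)
  next
    fix r g :: "'k fps fps"
    show "F (r ^ q * g) l = r * F g l"
      by (simp add: F_def slice_power_mult[OF X(1)[OF l]] slice_power_mult[OF Y(1)[OF l]] distrib_left mult.left_commute)
  qed
  have "\<exists>g\<in>isotypic n a (int i). \<forall>l<m. F g l = w l" if w: "\<forall>l<m. w l \<in> isotypic n a (int i)" for w
  proof -
    have "\<exists>\<alpha> \<beta>. \<alpha> \<in> isotypic n a 0 \<and> \<beta> \<in> isotypic n a 0 \<and> w l = mon i 0 * \<alpha> + mon 0 j * \<beta>" if "l < m" for l
      using corner_decompose[OF C] w that by metis
    then obtain \<alpha> \<beta> where ab: "\<And>l. l < m \<Longrightarrow> \<alpha> l \<in> isotypic n a 0" "\<And>l. l < m \<Longrightarrow> \<beta> l \<in> isotypic n a 0"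
        "\<And>l. l < m \<Longrightarrow> w l = mon i 0 * \<alpha> l + mon 0 j * \<beta> l"
      by metis
    \<comment> \<open>The slice \<open>xs l\<close> of \<open>gx l\<close> is \<open>x^c\<close>, and the slice \<open>ys l\<close> of \<open>gy l\<close> is \<open>y^d\<close>.\<close>
    define gx gy :: "nat \<Rightarrow> 'k fps fps" where "gx l = mon (fst (xs l) + q * cx l) (snd (xs l) + q * 0)"
      and "gy l = mon (fst (ys l) + q * 0) (snd (ys l) + q * dy l)" for l
    define g where "g = (\<Sum>l<m. \<alpha> l ^ q * gx l + \<beta> l ^ q * gy l)"
    have "gx l \<in> isotypic n a (int i)" "gy l \<in> isotypic n a (int i)" if "l < m" for l
      unfolding gx_def gy_def using X(2)[OF that] Y(2)[OF that]
      by (auto intro!: mon_in_isotypic simp: algebra_simps)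
    hence "\<alpha> l ^ q * gx l \<in> isotypic n a (int i)" "\<beta> l ^ q * gy l \<in> isotypic n a (int i)" if "l < m" for l
      using that ab by (auto intro: isotypic_power_mult)
    hence "g \<in> isotypic n a (int i)" unfolding g_def by (auto intro!: isotypic_sum isotypic_add)
    moreover have "F g l = w l" if l: "l < m" for l
    proof -
      have x1: "slice q (xs l) (gx l') = (if l' = l then mon (cx l) 0 else 0)"
       and x2: "slice q (xs l) (gy l') = (if l' = l \<and> xs l = ys l then mon 0 (dy l) else 0)"
       and y1: "slice q (ys l) (gx l') = (if l' = l \<and> xs l = ys l then mon (cx l) 0 else 0)"
       and y2: "slice q (ys l) (gy l') = (if l' = l then mon 0 (dy l) else 0)"
        if "l' < m" for l'
      proof -
        have iff: "xs l = xs l' \<longleftrightarrow> l' = l" "ys l = ys l' \<longleftrightarrow> l' = l"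
          using inj_on_eq_iff[OF ix] inj_on_eq_iff[OF iy] l that by auto
        have iff': "xs l = ys l' \<longleftrightarrow> l' = l \<and> xs l = ys l" "ys l = xs l' \<longleftrightarrow> l' = l \<and> xs l = ys l"
          using eq[of l l'] eq[of l' l] l that by metis+
        show "slice q (xs l) (gx l') = (if l' = l then mon (cx l) 0 else 0)"
          "slice q (xs l) (gy l') = (if l' = l \<and> xs l = ys l then mon 0 (dy l) else 0)"
          "slice q (ys l) (gx l') = (if l' = l \<and> xs l = ys l then mon (cx l) 0 else 0)"
          "slice q (ys l) (gy l') = (if l' = l then mon 0 (dy l) else 0)"
          unfolding gx_def gy_def slice_mon[OF X(1)[OF l] X(1)[OF that]] slice_mon[OF X(1)[OF l] Y(1)[OF that]]
            slice_mon[OF Y(1)[OF l] X(1)[OF that]] slice_mon[OF Y(1)[OF l] Y(1)[OF that]] iff iff'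
          by (auto split: if_split)
      qed
      have sx: "slice q (xs l) g = \<alpha> l * mon (cx l) 0 + (if xs l = ys l then \<beta> l * mon 0 (dy l) else 0)"
      proof -
        have "slice q (xs l) g = (\<Sum>l'<m. \<alpha> l' * slice q (xs l) (gx l') + \<beta> l' * slice q (xs l) (gy l'))"
          unfolding g_def slice_sum slice_add by (simp only: slice_power_mult[OF X(1)[OF l]])
        also have "\<dots> = (\<Sum>l'<m. if l' = l then \<alpha> l * mon (cx l) 0 + (if xs l = ys l then \<beta> l * mon 0 (dy l) else 0) else 0)"
          by (intro sum.cong refl) (auto simp: x1 x2)
        finally show ?thesis using l by simp
      qed
      have sy: "slice q (ys l) g = (if xs l = ys l then \<alpha> l * mon (cx l) 0 else 0) + \<beta> l * mon 0 (dy l)"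
      proof -
        have "slice q (ys l) g = (\<Sum>l'<m. \<alpha> l' * slice q (ys l) (gx l') + \<beta> l' * slice q (ys l) (gy l'))"
          unfolding g_def slice_sum slice_add by (simp only: slice_power_mult[OF Y(1)[OF l]])
        also have "\<dots> = (\<Sum>l'<m. if l' = l then (if xs l = ys l then \<alpha> l * mon (cx l) 0 else 0) + \<beta> l * mon 0 (dy l) else 0)"
          by (intro sum.cong refl) (auto simp: y1 y2)
        finally show ?thesis using l by simp
      qed
      have mx: "mon (i - cx l) 0 * (\<alpha> l * mon (cx l) 0) = mon i 0 * \<alpha> l"
      proof -
        have "mon i 0 = (mon (i - cx l) 0 * mon (cx l) 0 :: 'k fps fps)"
          using mon_add[of "i - cx l" "cx l" 0 0] cx[OF l] by simp
        thus ?thesis by (simp only: mult_ac)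
      qed
      have my: "mon 0 (j - dy l) * (\<beta> l * mon 0 (dy l)) = mon 0 j * \<beta> l"
      proof -
        have "mon 0 j = (mon 0 (j - dy l) * mon 0 (dy l) :: 'k fps fps)"
          using mon_add[of 0 0 "j - dy l" "dy l"] dy[OF l] by simp
        thus ?thesis by (simp only: mult_ac)
      qed
      show ?thesis
      proof (cases "xs l = ys l")
        case True
        hence "cx l = i" "dy l = j" using eq[OF l l] by auto
        thus ?thesis unfolding F_def sx ab(3)[OF l] using True by (simp add: algebra_simps)
      next
        case False
        thus ?thesis unfolding F_def sx sy ab(3)[OF l] by (simp only: if_False add_0_left add_0_right mx my)
      qed
    qed
    ultimately show ?thesis by blast
  qed
  thus ?thesis using hom unfolding twisted_surj_def by blast
qed

end

section \<open>The lower bound: matching the sources\<close>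

lemma source_cong: "[s = s'] (mod int n) \<Longrightarrow> source q n a t s = source q n a t s'"
proof -
  assume "[s = s'] (mod int n)"
  hence "[t - int q * s = t - int q * s'] (mod int n)" by (intro cong_diff cong_mult cong_refl)
  hence "[x = t - int q * s] (mod int n) \<longleftrightarrow> [x = t - int q * s'] (mod int n)" for x
    using cong_sym cong_trans by blast
  thus ?thesis by (simp add: source_def)
qed

lemma card_UN_source:
  assumes "finite I" and "0 < n"
    and "\<And>x y. x \<in> I \<Longrightarrow> y \<in> I \<Longrightarrow> x \<noteq> y \<Longrightarrow> source q n a t (f x) \<inter> source q n a t (f y) = {}"
  shows "card I * (q * (q div n)) \<le> card (\<Union>x\<in>I. source q n a t (f x))"
proof -
  have "card I * (q * (q div n)) \<le> (\<Sum>x\<in>I. card (source q n a t (f x)))"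
    using sum_bounded_below[of I "q * (q div n)" "\<lambda>x. card (source q n a t (f x))"] source_card[OF \<open>0 < n\<close>]
    by simp
  thus ?thesis using assms by (subst card_UN_disjoint) (auto simp: source_finite)
qed

lemma disjoint_subsets_UN:
  assumes "X \<subseteq> (\<Union>x\<in>I. f x)" and "Y \<subseteq> (\<Union>y\<in>J. g y)"
    and "\<And>x y. x \<in> I \<Longrightarrow> y \<in> J \<Longrightarrow> f x \<inter> g y = {}"
  shows "X \<inter> Y = {}"
  using assms by blast

context
  fixes q e n a i j :: nat
  assumes char: "prime CHAR('k::alg_closed_field)" and q: "q = CHAR('k) ^ e"
    and C: "corner_pair n a i j" and cop: "coprime q n"
begin

abbreviation "xsource c \<equiv> source q n a (int i) (int c)"
abbreviation "ysource d \<equiv> source q n a (int i) (int d * int a)"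

lemma corner_facts: "0 < i" "i < n" "0 < j" "j < n" "0 < n" "coprime a n" "[int i = int j * int a] (mod int n)"
  using C by (auto simp: corner_pair_def)

lemma xsource_disjoint: "c \<le> i \<Longrightarrow> c' \<le> i \<Longrightarrow> c \<noteq> c' \<Longrightarrow> xsource c \<inter> xsource c' = {}"
  using source_disjoint[OF cop, of _ a "int i" "int c" "int c'"] corner_facts
    cong_less_modulus_unique_nat[of c c' n]
  by (force simp: cong_int_iff)

lemma ysource_disjoint: "d \<le> j \<Longrightarrow> d' \<le> j \<Longrightarrow> d \<noteq> d' \<Longrightarrow> ysource d \<inter> ysource d' = {}"
  using source_disjoint[OF cop, of _ a "int i" "int d * int a" "int d' * int a"] corner_facts
    cong_less_modulus_unique_nat[of d d' n] cong_mult_rcancel[of "int a" "int n" "int d" "int d'"]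
  by (force simp: cong_int_iff)

lemma xysource_disjoint:
  assumes "c \<le> i" "d \<le> j" "\<not> (c = 0 \<and> d = 0)" "\<not> (c = i \<and> d = j)"
  shows "xsource c \<inter> ysource d = {}"
  using source_disjoint[OF cop, of _ a "int i" "int c" "int d * int a"] corner_pair_inj[OF C assms(1,2)] assms(3,4)
  by blast

text \<open>A copy of \<open>M_i\<close> among the slices serves both generators at once, and there are at least
  \<open>q * (q div n)\<close> of these. In addition, each pair formed by a
  source of \<open>x^i\<close> in \<open>X\<close> and a source of \<open>y^j\<close> in \<open>Y\<close> yields one more copy.\<close>

lemma twisted_surj_of_disjoint_sets:
  assumes X: "X \<subseteq> (\<Union>c<i. xsource c)" and Y: "Y \<subseteq> (\<Union>d<j. ysource d)"
    and XY: "X \<inter> Y = {}" "card X = card Y"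
  shows "\<exists>F :: 'k fps fps \<Rightarrow> nat \<Rightarrow> 'k fps fps. twisted_surj n a (int i) q (q * (q div n) + card X) F"
proof -
  have fin: "finite X" "finite Y"
    using finite_subset[OF X] finite_subset[OF Y] by (simp_all add: source_finite)
  obtain D where D: "D \<subseteq> xsource i" "card D = q * (q div n)" "finite D"
    using obtain_subset_with_card_n[OF source_card[OF corner_facts(5)]] by metis
  have DY: "D \<subseteq> ysource j" using D(1) source_cong[OF corner_facts(7)] by simp
  have "D \<inter> X = {}"
  proof (rule ccontr)
    assume "D \<inter> X \<noteq> {}"
    then obtain z c where "z \<in> xsource i" "c < i" "z \<in> xsource c" using D(1) X by blast
    thus False using xsource_disjoint[of c i] by auto
  qed
  have "D \<inter> Y = {}"
  proof (rule ccontr)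
    assume "D \<inter> Y \<noteq> {}"
    then obtain z d where "z \<in> ysource j" "d < j" "z \<in> ysource d" using DY Y by blast
    thus False using ysource_disjoint[of d j] by auto
  qed
  define m where "m = card D + card X"
  have cDX: "card (D \<union> X) = m" unfolding m_def
    using D(3) fin \<open>D \<inter> X = {}\<close> by (simp add: card_Un_disjoint)
  obtain h where h: "bij_betw h {..<m} (D \<union> X)"
    using ex_bij_betw_nat_finite[of "D \<union> X"] D(3) fin cDX by (auto simp: atLeast0LessThan)
  obtain \<pi> where \<pi>: "bij_betw \<pi> X Y" using fin XY finite_same_card_bij by blast
  define ys where "ys l = (if h l \<in> D then h l else \<pi> (h l))" for l
  have hl: "h l \<in> D \<or> h l \<in> X \<and> h l \<notin> D" if "l < m" for l
    using h that by (auto simp: bij_betw_def)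
  have \<pi>X: "\<pi> z \<in> Y" if "z \<in> X" for z using \<pi> that by (auto simp: bij_betw_def)
  have "\<exists>c d. h l \<in> xsource c \<and> c \<le> i \<and> ys l \<in> ysource d \<and> d \<le> j \<and> (h l \<in> D \<longrightarrow> c = i \<and> d = j)"
    if l: "l < m" for l
  proof (cases "h l \<in> D")
    case True
    thus ?thesis using D(1) DY unfolding ys_def by (intro exI[of _ i] exI[of _ j]) auto
  next
    case False
    hence "h l \<in> X" using hl[OF l] by blast
    then obtain c where c: "c < i" "h l \<in> xsource c" using X by blast
    have "\<pi> (h l) \<in> Y" using \<pi>X \<open>h l \<in> X\<close> by blast
    then obtain d where d: "d < j" "\<pi> (h l) \<in> ysource d" using Y by blast
    show ?thesis using False c d unfolding ys_def by (intro exI[of _ c] exI[of _ d]) auto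
  qed
  then obtain cx dy where cd: "\<And>l. l < m \<Longrightarrow> h l \<in> xsource (cx l) \<and> cx l \<le> i \<and> ys l \<in> ysource (dy l) \<and> dy l \<le> j
      \<and> (h l \<in> D \<longrightarrow> cx l = i \<and> dy l = j)"
    by metis
  have hinj: "inj_on h {..<m}" using h by (simp add: bij_betw_def)
  have iy: "inj_on ys {..<m}"
  proof (rule inj_onI)
    fix l l' assume l: "l \<in> {..<m}" "l' \<in> {..<m}" and e: "ys l = ys l'"
    have "h l = h l'"
    proof (cases "h l \<in> D"; cases "h l' \<in> D")
      assume "h l \<notin> D" "h l' \<notin> D"
      moreover from this have "h l \<in> X" "h l' \<in> X" using hl l by blast+
      moreover have "inj_on \<pi> X" using \<pi> by (simp add: bij_betw_def)
      ultimately show ?thesis using e by (simp add: ys_def inj_on_eq_iff)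
    qed (use e l hl[of l] hl[of l'] \<pi>X[of "h l"] \<pi>X[of "h l'"] \<open>D \<inter> Y = {}\<close> in \<open>auto simp: ys_def\<close>)
    thus "l = l'" using hinj l by (auto dest: inj_onD)
  qed
  have eq: "l = l' \<and> cx l = i \<and> dy l = j" if l: "l < m" "l' < m" and e: "h l = ys l'" for l l'
  proof (cases "h l' \<in> D")
    case True
    hence "h l = h l'" using e by (simp add: ys_def)
    hence "l = l'" using hinj l by (auto dest: inj_onD)
    thus ?thesis using cd[OF l(2)] True by simp
  next
    case False
    hence "h l \<in> Y" using e hl[OF l(2)] \<pi>X by (simp add: ys_def)
    thus ?thesis using hl[OF l(1)] \<open>D \<inter> Y = {}\<close> XY(1) by blast
  qed
  have "\<exists>F :: 'k fps fps \<Rightarrow> nat \<Rightarrow> 'k fps fps. twisted_surj n a (int i) q m F"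
    by (rule twisted_surj_of_sources[OF char q C cop, of m h cx ys dy]) (use cd hinj iy eq in auto)
  thus ?thesis unfolding m_def D(2) .
qed

text \<open>The copies of \<open>R\<close> are all spent on the scarcer generator: with \<open>i < j\<close> the classes
  \<open>0, ..., i - 1\<close> supply \<open>x^i\<close>, and \<open>i\<close> of the \<open>j - 1\<close> classes of \<open>y, ..., y^(j-1)\<close> suffice to
  match them.\<close>

lemma twisted_surj_exists_less:
  assumes "i < j"
  shows "\<exists>F :: 'k fps fps \<Rightarrow> nat \<Rightarrow> 'k fps fps. twisted_surj n a (int i) q ((i + 1) * (q * (q div n))) F"
proof -
  let ?L = "q * (q div n)"
  have "card {..<i} * ?L \<le> card (\<Union>c<i. xsource c)"
    by (rule card_UN_source[OF _ corner_facts(5)]) (use xsource_disjoint in auto)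
  then obtain X where X: "X \<subseteq> (\<Union>c<i. xsource c)" "card X = i * ?L"
    using obtain_subset_with_card_n by (metis card_lessThan)
  have "card {1..i} * ?L \<le> card (\<Union>d\<in>{1..i}. ysource d)"
    by (rule card_UN_source[OF _ corner_facts(5)]) (use ysource_disjoint assms in auto)
  then obtain Y where Y: "Y \<subseteq> (\<Union>d\<in>{1..i}. ysource d)" "card Y = i * ?L"
    using obtain_subset_with_card_n by (metis card_atLeastAtMost diff_Suc_1 One_nat_def)
  have "X \<inter> Y = {}"
    by (rule disjoint_subsets_UN[OF X(1) Y(1)], rule xysource_disjoint) (use assms in auto)
  moreover have "(\<Union>d\<in>{1..i}. ysource d) \<subseteq> (\<Union>d<j. ysource d)"
    using assms by (intro UN_mono) auto
  hence "Y \<subseteq> (\<Union>d<j. ysource d)" using Y(1) by (rule order_trans[rotated])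
  ultimately show ?thesis
    using twisted_surj_of_disjoint_sets[OF X(1), of Y] X(2) Y(2) by (simp add: algebra_simps)
qed

lemma twisted_surj_exists_greater:
  assumes "j < i"
  shows "\<exists>F :: 'k fps fps \<Rightarrow> nat \<Rightarrow> 'k fps fps. twisted_surj n a (int i) q ((j + 1) * (q * (q div n))) F"
proof -
  let ?L = "q * (q div n)"
  have "card {..<j} * ?L \<le> card (\<Union>d<j. ysource d)"
    by (rule card_UN_source[OF _ corner_facts(5)]) (use ysource_disjoint in auto)
  then obtain Y where Y: "Y \<subseteq> (\<Union>d<j. ysource d)" "card Y = j * ?L"
    using obtain_subset_with_card_n by (metis card_lessThan)
  have "card {1..j} * ?L \<le> card (\<Union>c\<in>{1..j}. xsource c)"
    by (rule card_UN_source[OF _ corner_facts(5)]) (use xsource_disjoint assms in auto)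
  then obtain X where X: "X \<subseteq> (\<Union>c\<in>{1..j}. xsource c)" "card X = j * ?L"
    using obtain_subset_with_card_n by (metis card_atLeastAtMost diff_Suc_1 One_nat_def)
  have "X \<inter> Y = {}"
    by (rule disjoint_subsets_UN[OF X(1) Y(1)], rule xysource_disjoint) (use assms in auto)
  moreover have "(\<Union>c\<in>{1..j}. xsource c) \<subseteq> (\<Union>c<i. xsource c)"
    using assms by (intro UN_mono) auto
  hence "X \<subseteq> (\<Union>c<i. xsource c)" using X(1) by (rule order_trans[rotated])
  ultimately show ?thesis
    using twisted_surj_of_disjoint_sets[OF _ Y(1), of X] X(2) Y(2) by (simp add: algebra_simps)
qed

text \<open>With \<open>i = j\<close> both generators have \<open>i - 1\<close> classes of their own, and the copies of \<open>R\<close> have to be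
  divided evenly between them.\<close>

lemma twisted_surj_exists_equal:
  assumes "i = j"
  shows "\<exists>F :: 'k fps fps \<Rightarrow> nat \<Rightarrow> 'k fps fps. twisted_surj n a (int i) q (i * (q * (q div n)) + q * (q div n) div 2) F"
proof -
  define L where "L = q * (q div n)"
  have "card {1..<i} * L \<le> card (\<Union>c\<in>{1..<i}. xsource c)" unfolding L_def
    by (rule card_UN_source[OF _ corner_facts(5)]) (use xsource_disjoint in auto)
  then obtain X where X: "X \<subseteq> (\<Union>c\<in>{1..<i}. xsource c)" "card X = (i - 1) * L" "finite X"
    using obtain_subset_with_card_n by (metis card_atLeastLessThan)
  have "card {1..<i} * L \<le> card (\<Union>d\<in>{1..<i}. ysource d)" unfolding L_def
    by (rule card_UN_source[OF _ corner_facts(5)]) (use ysource_disjoint assms in auto)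
  then obtain Y where Y: "Y \<subseteq> (\<Union>d\<in>{1..<i}. ysource d)" "card Y = (i - 1) * L" "finite Y"
    using obtain_subset_with_card_n by (metis card_atLeastLessThan)
  have L: "L \<le> card (xsource 0)" unfolding L_def by (rule source_card[OF corner_facts(5)])
  hence "L div 2 \<le> card (xsource 0)" by simp
  then obtain R where R: "R \<subseteq> xsource 0" "card R = L div 2" "finite R"
    using obtain_subset_with_card_n by metis
  have "L div 2 \<le> card (xsource 0 - R)" using L R by (simp add: card_Diff_subset)
  then obtain R' where R': "R' \<subseteq> xsource 0 - R" "card R' = L div 2" "finite R'"
    using obtain_subset_with_card_n by metis
  have y0: "ysource 0 = xsource 0" by simp
  have XR: "X \<inter> xsource 0 = {}"
    by (rule disjoint_subsets_UN[OF X(1), where J = "{0}" and g = xsource], simp, rule xsource_disjoint) auto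
  have "Y \<inter> ysource 0 = {}"
    by (rule disjoint_subsets_UN[OF Y(1), where J = "{0}" and g = ysource], simp, rule ysource_disjoint) (use assms in auto)
  hence YR: "Y \<inter> xsource 0 = {}" unfolding y0 .
  have XY: "X \<inter> Y = {}"
    by (rule disjoint_subsets_UN[OF X(1) Y(1)], rule xysource_disjoint) (use assms in auto)
  have cX: "card (X \<union> R) = (i - 1) * L + L div 2" using X R XR by (subst card_Un_disjoint) auto
  have cY: "card (Y \<union> R') = (i - 1) * L + L div 2" using Y R' YR by (subst card_Un_disjoint) auto
  have dis: "(X \<union> R) \<inter> (Y \<union> R') = {}" using XR YR XY R R' by blast
  have sX: "X \<union> R \<subseteq> (\<Union>c<i. xsource c)"
  proof -
    have "(\<Union>c\<in>{1..<i}. xsource c) \<subseteq> (\<Union>c<i. xsource c)" by (intro UN_mono) auto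
    moreover have "xsource 0 \<subseteq> (\<Union>c<i. xsource c)" using corner_facts(1) by (intro UN_upper) auto
    ultimately show ?thesis by (intro Un_least order_trans[OF X(1)] order_trans[OF R(1)])
  qed
  have sY: "Y \<union> R' \<subseteq> (\<Union>d<j. ysource d)"
  proof -
    have "(\<Union>d\<in>{1..<i}. ysource d) \<subseteq> (\<Union>d<j. ysource d)" using assms by (intro UN_mono) auto
    moreover have "ysource 0 \<subseteq> (\<Union>d<j. ysource d)" using corner_facts(3) by (intro UN_upper) auto
    hence "R' \<subseteq> (\<Union>d<j. ysource d)" unfolding y0
      by (rule order_trans[OF order_trans[OF R'(1) Diff_subset]])
    ultimately show ?thesis by (intro Un_least order_trans[OF Y(1)])
  qed
  have m: "q * (q div n) + card (X \<union> R) = i * (q * (q div n)) + q * (q div n) div 2"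
    unfolding cX unfolding L_def[symmetric] using corner_facts(1) by (cases i) simp_all
  have "card (X \<union> R) = card (Y \<union> R')" unfolding cX cY ..
  from twisted_surj_of_disjoint_sets[OF sX sY dis this] show ?thesis unfolding m .
qed

section \<open>The number of copies up to rounding\<close>

text \<open>The three bounds come from the coefficient of \<open>x^i\<close>, from that of \<open>y^j\<close>, and from both. For
  the last one it matters that the two boxes of relevant monomials share the square of side \<open>q\<close>:
  the monomials in it belong to the copies of \<open>R\<close>, each of which fills one dimension only, and
  they are counted once.\<close>

lemma twisted_surj_bounds:
  fixes F :: "'k fps fps \<Rightarrow> nat \<Rightarrow> 'k fps fps"
  assumes F: "twisted_surj n a (int i) q m F"
  shows "m \<le> q * (q * (i + 1) div n + 1)"
    and "m \<le> q * (j + 1) * (q div n + 1)"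
    and "2 * m \<le> q * (q * (i + 1) div n + 1) + q * j * (q div n + 1)"
proof -
  have q0: "0 < q" by (rule q_pos[OF char q])
  define box where "box X Y = {(A, B). A < X \<and> B \<in> Y \<and> [int A + int B * int a = int i] (mod int n)}" for X and Y :: "nat set"
  have fin: "finite (box X Y)" if "finite Y" for X Y
    by (rule finite_subset[of _ "{..<X} \<times> Y"]) (use that in \<open>auto simp: box_def\<close>)
  have card: "card (box X Y) \<le> card Y * (X div n + 1)" if "finite Y" for X Y
    unfolding box_def by (rule card_cong_rectangle(2)[OF corner_facts(5) that])
  have hom: "twisted_hom n a (int i) q (\<lambda>g. F g l)" if "l < m" for l
    using F that by (simp add: twisted_surj_def)
  note facts = corner_facts
  have K: "fst x < n \<and> snd x < n \<and> mon (fst x) (snd x) \<in> (isotypic n a (int i) :: 'k fps fps set)"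
    if "x \<in> {(i, 0), (0, j)}" for x
    using that facts cong_sym[OF facts(7)] by (auto simp: mon_mem_isotypic_iff)
  have sx: "(A, B) \<in> box (q * (i + 1)) {..<q}"
    if "mon A B \<in> (isotypic n a (int i) :: 'k fps fps set)" "l < m" "F (mon A B) l $ i $ 0 \<noteq> 0" for A B l
    using support_x[OF hom[OF that(2)] facts(5,6) q0 that(1,3)] that(1) by (simp add: box_def mon_mem_isotypic_iff)
  have sy: "(A, B) \<in> box q {..<q * (j + 1)}"
    if "mon A B \<in> (isotypic n a (int i) :: 'k fps fps set)" "l < m" "F (mon A B) l $ 0 $ j \<noteq> 0" for A B l
    using support_y[OF hom[OF that(2)] facts(5,6) q0 that(1,3)] that(1) by (simp add: box_def mon_mem_isotypic_iff)
  have "m * card {(i, 0::nat)} \<le> card (box (q * (i + 1)) {..<q})"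
    by (rule twisted_surj_card_bound[OF F facts(5) q0]) (use K facts(2,4,5) sx fin in auto)
  also have "\<dots> \<le> q * (q * (i + 1) div n + 1)" using card[of "{..<q}" "q * (i + 1)"] by simp
  finally show "m \<le> q * (q * (i + 1) div n + 1)" by simp
  have "m * card {(0::nat, j)} \<le> card (box q {..<q * (j + 1)})"
    by (rule twisted_surj_card_bound[OF F facts(5) q0]) (use K facts(2,4,5) sy fin in auto)
  also have "\<dots> \<le> q * (j + 1) * (q div n + 1)" using card[of "{..<q * (j + 1)}" q] by simp
  finally show "m \<le> q * (j + 1) * (q div n + 1)" by simp
  have "m * card {(i, 0), (0, j)} \<le> card (box (q * (i + 1)) {..<q} \<union> box q {q..<q * (j + 1)})"
  proof (rule twisted_surj_card_bound[OF F facts(5) q0 _ K])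
    fix A B l x
    \<comment> \<open>The box for \<open>y^j\<close> is split at height \<open>q\<close>; its lower part lies in the box for \<open>x^i\<close>.\<close>
    assume *: "mon A B \<in> (isotypic n a (int i) :: 'k fps fps set)" "l < m" "x \<in> {(i, 0), (0, j)}"
      "F (mon A B) l $ fst x $ snd x \<noteq> 0"
    hence "(A, B) \<in> box (q * (i + 1)) {..<q} \<or> (A, B) \<in> box q {..<q * (j + 1)}"
      using sx sy by auto
    thus "(A, B) \<in> box (q * (i + 1)) {..<q} \<union> box q {q..<q * (j + 1)}"
      by (auto simp: box_def)
  qed (use fin in auto)
  also have "\<dots> \<le> card (box (q * (i + 1)) {..<q}) + card (box q {q..<q * (j + 1)})" by (rule card_Un_le)
  also have "\<dots> \<le> q * (q * (i + 1) div n + 1) + q * j * (q div n + 1)"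
    using card[of "{..<q}" "q * (i + 1)"] card[of "{q..<q * (j + 1)}" q] by (intro add_mono) auto
  also have "card {(i, 0), (0, j)} = 2" using facts by simp
  finally show "2 * m \<le> q * (q * (i + 1) div n + 1) + q * j * (q div n + 1)" by simp
qed

text \<open>The deviation from \<open>s q^2\<close> is the rounding error of \<open>q / n\<close>, at most \<open>1\<close> for each row of a box
  of monomials and each class of sources. Since \<open>i\<close> and \<open>j\<close> are below \<open>n\<close>, these errors add up to
  at most a constant times \<open>n q\<close>.\<close>

lemma twisted_surj_number_bounds:
  defines "b \<equiv> Max {m. \<exists>F :: 'k fps fps \<Rightarrow> nat \<Rightarrow> 'k fps fps. twisted_surj n a (int i) q m F}"
    and "s \<equiv> (if i \<noteq> j then (real (min i j) + 1) / real n else (2 * real i + 1) / (2 * real n))"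
  shows "\<bar>real b - s * real q ^ 2\<bar> \<le> 2 * real n * real q"
proof -
  define S where "S = {m. \<exists>F :: 'k fps fps \<Rightarrow> nat \<Rightarrow> 'k fps fps. twisted_surj n a (int i) q m F}"
  define D where "D = real (q div n)"
  note facts = corner_facts
  have q1: "real q \<ge> 1" using q_pos[OF char q] by simp
  have div_le: "real (x div n) \<le> real x / real n" for x by (rule of_nat_div_le_of_nat)
  have "q < n * (q div n + 1)"
    using dividend_less_times_div[OF facts(5), of q] by (simp add: algebra_simps)
  hence "real q < real n * (D + 1)" unfolding D_def by (metis of_nat_1 of_nat_add of_nat_less_iff of_nat_mult)
  hence D: "D \<le> real q / real n" "real q / real n - 1 \<le> D"
    using div_le[of q] facts(5) by (simp_all add: D_def field_simps)
  have fin: "finite S"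
    using twisted_surj_bounds(1) by (intro finite_subset[of S "{..q * (q * (i + 1) div n + 1)}"]) (auto simp: S_def)
  have lower: "m \<le> b" if "m \<in> S" for m
    unfolding b_def S_def[symmetric] using fin that by simp
  have memE: "b \<in> S" if "S \<noteq> {}" unfolding b_def S_def[symmetric] using fin that by simp
  have qD: "real q * D \<le> real q ^ 2 / real n" "real q ^ 2 / real n - real q \<le> real q * D"
  proof -
    have "real q * D \<le> real q * (real q / real n)" using D by (intro mult_left_mono) auto
    thus "real q * D \<le> real q ^ 2 / real n" by (simp add: power2_eq_square)
    have "real q * (real q / real n - 1) \<le> real q * D" using D by (intro mult_left_mono) auto
    thus "real q ^ 2 / real n - real q \<le> real q * D" by (simp add: power2_eq_square algebra_simps)
  qed
  define Q where "Q = real q ^ 2 / real n"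
  have b1: "real m \<le> (real i + 1) * Q + real q"
    and b2: "real m \<le> (real j + 1) * Q + (real j + 1) * real q"
    and b3: "2 * real m \<le> (real i + real j + 1) * Q + (real j + 1) * real q" if mS: "m \<in> S" for m
  proof -
    obtain F :: "'k fps fps \<Rightarrow> nat \<Rightarrow> 'k fps fps" where F: "twisted_surj n a (int i) q m F"
      using mS unfolding S_def by blast
    note B = twisted_surj_bounds[OF F]
    have x: "real q * real (q * (i + 1) div n) \<le> (real i + 1) * Q"
    proof -
      have "real q * real (q * (i + 1) div n) \<le> real q * (real (q * (i + 1)) / real n)"
        by (intro mult_left_mono div_le) auto
      thus ?thesis by (simp add: Q_def power2_eq_square algebra_simps)
    qed
    have y: "real k * (real q * D) \<le> real k * Q" for k
      using qD by (intro mult_left_mono) (auto simp: Q_def)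
    have "real m \<le> real (q * (q * (i + 1) div n + 1))" using B(1) by (simp only: of_nat_le_iff)
    also have "\<dots> = real q * real (q * (i + 1) div n) + real q" by (simp add: distrib_left del: of_nat_div)
    finally show "real m \<le> (real i + 1) * Q + real q" using x by linarith
    define X Y where "X = q * (i + 1) div n" and "Y = q div n"
    note B = B[folded X_def Y_def] and x = x[folded X_def]
    have DY: "D = real Y" by (simp add: D_def Y_def)
    have "real m \<le> real (q * (j + 1) * (Y + 1))" using B(2) by (simp only: of_nat_le_iff)
    also have "\<dots> = real (j + 1) * (real q * D) + (real j + 1) * real q" by (simp add: DY algebra_simps)
    also have "\<dots> \<le> real (j + 1) * Q + (real j + 1) * real q" by (intro add_right_mono y)
    finally show "real m \<le> (real j + 1) * Q + (real j + 1) * real q" by (simp add: add.commute)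
    have "real (2 * m) \<le> real (q * (X + 1) + q * j * (Y + 1))" by (rule of_nat_mono[OF B(3)])
    also have "\<dots> = real q * real X + real q + (real j * (real q * D) + real j * real q)"
      by (simp add: DY algebra_simps)
    also have "\<dots> \<le> (real i + 1) * Q + real q + (real j * Q + real j * real q)"
      by (intro add_right_mono add_mono x y)
    also have "\<dots> = (real i + real j + 1) * Q + (real j + 1) * real q" by (simp add: distrib_right)
    finally show "2 * real m \<le> (real i + real j + 1) * Q + (real j + 1) * real q" by simp
  qed
  have lo: "x * Q - x * real q \<le> real (k * (q * (q div n)))" if "x = real k" for x k
  proof -
    have "real k * (Q - real q) \<le> real k * (real q * D)" using qD by (intro mult_left_mono) (auto simp: Q_def)
    thus ?thesis by (simp add: that D_def right_diff_distrib)
  qed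
  have kq: "(real k + 1) * real q \<le> real n * real q" "real q \<le> (real k + 1) * real q" if "k < n" for k
  proof -
    show "(real k + 1) * real q \<le> real n * real q" using that by (intro mult_right_mono) auto
    have "1 * real q \<le> (real k + 1) * real q" by (intro mult_right_mono) auto
    thus "real q \<le> (real k + 1) * real q" by simp
  qed
  note ki = kq[OF facts(2)] and kj = kq[OF facts(4)]
  show ?thesis
  proof (cases i j rule: linorder_cases)
    case less
    have s: "s * real q ^ 2 = (real i + 1) * Q" using less by (simp add: s_def Q_def)
    have m: "(i + 1) * (q * (q div n)) \<in> S" using twisted_surj_exists_less[OF less] by (simp add: S_def)
    have "real ((i + 1) * (q * (q div n))) \<le> real b" using lower[OF m] by (simp only: of_nat_le_iff)
    moreover have "b \<in> S" using m memE by blast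
    moreover have "real i + 1 = real (i + 1)" by simp
    ultimately show ?thesis unfolding s using lo[of "real i + 1" "i + 1"] b1[of b] ki by linarith
  next
    case greater
    have s: "s * real q ^ 2 = (real j + 1) * Q" using greater by (simp add: s_def Q_def)
    have m: "(j + 1) * (q * (q div n)) \<in> S" using twisted_surj_exists_greater[OF greater] by (simp add: S_def)
    have "real ((j + 1) * (q * (q div n))) \<le> real b" using lower[OF m] by (simp only: of_nat_le_iff)
    moreover have "b \<in> S" using m memE by blast
    moreover have "real j + 1 = real (j + 1)" by simp
    ultimately show ?thesis unfolding s using lo[of "real j + 1" "j + 1"] b2[of b] kj by linarith
  next
    case equal
    have s: "s * real q ^ 2 = (2 * real i + 1) * Q / 2" using equal facts(5) by (simp add: s_def Q_def field_simps)
    have m: "i * (q * (q div n)) + q * (q div n) div 2 \<in> S" using twisted_surj_exists_equal[OF equal] by (simp add: S_def)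
    \<comment> \<open>Dividing the copies of \<open>R\<close> evenly may leave one of them over.\<close>
    have "(2 * i + 1) * (q * (q div n)) \<le> 2 * (i * (q * (q div n)) + q * (q div n) div 2) + 1"
      by (simp add: algebra_simps)
    also have "\<dots> \<le> 2 * b + 1" using lower[OF m] by simp
    finally have "real ((2 * i + 1) * (q * (q div n))) \<le> real (2 * b + 1)" by (rule of_nat_mono)
    moreover have "real (2 * b + 1) = 2 * real b + 1" "2 * real i + 1 = real (2 * i + 1)" by simp_all
    ultimately have "(2 * real i + 1) * Q - (2 * real i + 1) * real q \<le> 2 * real b + 1"
      using lo[of "2 * real i + 1" "2 * i + 1"] by linarith
    moreover have "2 * real b \<le> (real i + real i + 1) * Q + (real i + 1) * real q"
      using b3[of b] m memE unfolding equal[symmetric] by blast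
    moreover define P V N where "P = (2 * real i + 1) * Q" and "V = (real i + 1) * real q" and "N = real n * real q"
    ultimately have "P - (2 * V - real q) \<le> 2 * real b + 1" "2 * real b \<le> P + V"
      by (simp_all add: algebra_simps)
    moreover have "V \<le> N" "0 \<le> N" using ki(1) by (simp_all add: V_def N_def)
    ultimately have "\<bar>real b - P / 2\<bar> \<le> 2 * N" using q1 by linarith
    thus ?thesis unfolding s P_def N_def by (simp only: mult.assoc)
  qed
qed

end

lemma tendsto_of_linear_error:
  fixes x :: "nat \<Rightarrow> real"
  assumes "1 < p" and bd: "\<And>e. \<bar>x e - s * real (p ^ e) ^ 2\<bar> \<le> c * real (p ^ e)"
  shows "(\<lambda>e. x e / real p ^ (e * 2)) \<longlonglongrightarrow> s"
proof -
  have "(\<lambda>e. c * (1 / real p) ^ e) \<longlonglongrightarrow> 0"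
    using \<open>1 < p\<close> by (intro tendsto_mult_right_zero LIMSEQ_realpow_zero) auto
  moreover have "\<bar>x e / real p ^ (e * 2) - s\<bar> \<le> c * (1 / real p) ^ e" for e
  proof -
    have pos: "real p ^ e > 0" using \<open>1 < p\<close> by simp
    have "x e / real p ^ (e * 2) - s = (x e - s * real (p ^ e) ^ 2) / real (p ^ e) ^ 2"
      using pos by (simp add: power_mult diff_divide_distrib)
    also have "\<bar>\<dots>\<bar> = \<bar>x e - s * real (p ^ e) ^ 2\<bar> / real (p ^ e) ^ 2" by simp
    also have "\<dots> \<le> (c * real (p ^ e)) / real (p ^ e) ^ 2" by (intro divide_right_mono bd) simp
    also have "\<dots> = c * (1 / real p) ^ e" using pos by (simp add: power2_eq_square power_one_over)
    finally show ?thesis .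
  qed
  ultimately have "(\<lambda>e. x e / real p ^ (e * 2) - s) \<longlonglongrightarrow> 0"
    by (intro tendsto_rabs_zero_cancel[of "\<lambda>e. x e / real p ^ (e * 2) - s"])
       (rule tendsto_sandwich[OF _ _ tendsto_const], auto)
  thus ?thesis by (simp add: LIM_zero_iff)
qed

theorem theorem1p6:
  fixes \<zeta> :: "'k::alg_closed_field"
    and p n a t :: nat
    and \<alpha> :: "int list"
  assumes "CHAR('k) = p" and "p > 0"
    and "1 \<le> a" and "a \<le> n - 1" and "coprime a n" and "\<not> p dvd n"
    and "primitive_root_of_unity n \<zeta>"
    and "\<alpha> \<noteq> []" and "\<forall>c\<in>set \<alpha>. c \<ge> 2"
    and "hj_fraction \<alpha> = of_nat n / of_nat a"
    and "1 \<le> t" and "t \<le> length \<alpha>"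
  shows "has_dual_F_signature (invariant_ring (cyclic_diag_group \<zeta> a)) p 2
           (M_module n a (i_series n a \<alpha> t))
           (if i_series n a \<alpha> t \<noteq> j_series \<alpha> t
            then (real_of_int (min (i_series n a \<alpha> t) (j_series \<alpha> t)) + 1) / real n
            else (2 * real_of_int (i_series n a \<alpha> t) + 1) / (2 * real n))"
proof -
  have char: "prime CHAR('k)" using prime_CHAR_semidom[where 'a = 'k] assms(1,2) by simp
  obtain u where u: "t = Suc u" using assms(11) by (cases t) auto
  have "0 < i_series n a \<alpha> t" "0 < j_series \<alpha> t"
    using i_series_quotient[OF assms(9,10), of u] j_series_mono[OF assms(9), of u] assms u by auto
  then obtain i j where i: "i_series n a \<alpha> t = int i" and j: "j_series \<alpha> t = int j"
    using zero_less_imp_eq_int by metis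
  have C: "corner_pair n a i j"
    using series_corner_pair[OF assms(9,10,3,4,5,11,12) i j] .
  have cop: "coprime (p ^ e) n" for e
    using char assms(1,6) prime_imp_coprime[of p n] by simp
  have s: "(if i_series n a \<alpha> t \<noteq> j_series \<alpha> t
            then (real_of_int (min (i_series n a \<alpha> t) (j_series \<alpha> t)) + 1) / real n
            else (2 * real_of_int (i_series n a \<alpha> t) + 1) / (2 * real n))
       = (if i \<noteq> j then (real (min i j) + 1) / real n else (2 * real i + 1) / (2 * real n))"
    unfolding i j by (simp add: min_def)
  show ?thesis
    unfolding has_dual_F_signature_def dual_F_number_eq[OF assms(7)] s unfolding i
  proof (rule tendsto_of_linear_error)
    show "1 < p" using char assms(1) prime_gt_1_nat by blast
    show "\<bar>real (Max {m. \<exists>F :: 'k fps fps \<Rightarrow> nat \<Rightarrow> 'k fps fps. twisted_surj n a (int i) (p ^ e) m F})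
        - (if i \<noteq> j then (real (min i j) + 1) / real n else (2 * real i + 1) / (2 * real n)) * real (p ^ e) ^ 2\<bar>
      \<le> 2 * real n * real (p ^ e)" for e
      by (rule twisted_surj_number_bounds[OF char _ C cop]) (simp add: assms(1))
  qed
qed

end
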